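(* Let $A \in \mathbb{F}_2[x]$ be an even, non-splitting polynomial all of whose odd irreducible divisors belong to $\mathcal{F}=\{M_1,\ldots,M_{13},S_1,\ldots,S_{15}\}$. Then $A$ is an indecomposable perfect polynomial if and only if $A, \overline{A} \in \{T_1, \ldots, T_{11}\}$.
   Context: All polynomials are in $\mathbb{F}_2[x]$. A nonzero polynomial is even if it has a linear factor ($x$ or $x+1$), and odd otherwise. $\sigma(A)$ denotes the sum of all monic divisors of $A$, and $\omega(A)$ the number of distinct irreducible factors of $A$. $A$ splits if $A$ is even and $\omega(A)\le 2$. $A$ is perfect if $\sigma(A)=A$. A perfect polynomial is indecomposable if it is not the product of two coprime nonconstant perfect polynomials. For $Q\in\mathbb{F}_2[x]$, $\overline{Q}(x)=Q(x+1)$. $M_1=1+x+x^2$, $M_2=1+x+x^3$, $M_3=1+x^2+x^3$, $M_4=1+x+x^2+x^3+x^4$, $M_5=1+x^3+x^4$, $M_6=1+x^3+x^5$, $M_7=1+x^3+x^7$, $M_8=1+x^6+x^7$, $M_9=\overline{M_6}$, $M_{10}=\overline{M_7}$, $M_{11}=\overline{M_8}$, $M_{12}=1+x+x^9$, $M_{13}=1+x^8+x^9$. $S_1=1+x(x+1)M_1$, $S_2=1+x^2(x+1)^2M_1$, $S_3=1+x(x+1)^3M_1^4$, $S_4=1+x^3(x+1)M_1$, $S_5=1+x(x+1)^3M_1$, $S_6=1+x^3(x+1)M_1^4$, $S_7=1+x(x+1)M_1^3$, $S_8=1+x^3(x+1)^3M_1$, $S_9=1+x(x+1)M_1^5$,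 $S_{10}=1+x^4(x+1)M_1$, $S_{11}=1+x(x+1)^2M_1$, $S_{12}=1+x^2(x+1)M_1^2$, $S_{13}=1+x(x+1)^4M_1$, $S_{14}=1+x^2(x+1)M_1$, $S_{15}=1+x(x+1)^2M_1^2$. $T_1=x^2(x+1)M_1$, $T_2=\overline{T_1}$, $T_3=x^4(x+1)^3M_4$, $T_4=\overline{T_3}$, $T_5=x^4(x+1)^4M_4\overline{M_4}$, $T_6=x^6(x+1)^3M_2\overline{M_2}$, $T_7=\overline{T_6}$, $T_8=x^4(x+1)^6M_2\overline{M_2}M_4$, $T_9=\overline{T_8}$, $T_{10}=x^2(x+1)M_1^2(1+x+x^4)$, $T_{11}=\overline{T_{10}}$. *)

theory Defs
  imports "HOL-Library.Z2" "HOL-Computational_Algebra.Computational_Algebra"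
begin

(* The type "bit" of HOL-Library.Z2 is the field with two elements, so "bit poly" is F_2[x]. *)

abbreviation X :: "bit poly" where
  "X \<equiv> [:0, 1:]"

definition even_poly :: "bit poly \<Rightarrow> bool" where
  "even_poly A \<longleftrightarrow> A \<noteq> 0 \<and> (X dvd A \<or> X + 1 dvd A)"

definition odd_poly :: "bit poly \<Rightarrow> bool" where
  "odd_poly A \<longleftrightarrow> A \<noteq> 0 \<and> \<not> even_poly A"

definition sigma :: "bit poly \<Rightarrow> bit poly" where
  "sigma A = (\<Sum>D | lead_coeff D = 1 \<and> D dvd A. D)"

(* The only unit of F_2[x] is 1, so distinct irreducibles are never associated. *)
definition omega :: "bit poly \<Rightarrow> nat" where
  "omega A = card {P. irreducible P \<and> P dvd A}"

definition splits :: "bit poly \<Rightarrow> bool" where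
  "splits A \<longleftrightarrow> even_poly A \<and> omega A \<le> 2"

(* The zero polynomial is excluded: its set of monic divisors is infinite, so that
   "sigma 0" would be 0 by the convention for sums over infinite sets. *)
definition perfect_poly :: "bit poly \<Rightarrow> bool" where
  "perfect_poly A \<longleftrightarrow> A \<noteq> 0 \<and> sigma A = A"

definition indecomposable_perfect :: "bit poly \<Rightarrow> bool" where
  "indecomposable_perfect A \<longleftrightarrow> perfect_poly A \<and>
    \<not> (\<exists>B C. A = B * C \<and> coprime B C \<and> degree B > 0 \<and> degree C > 0 \<and>
            perfect_poly B \<and> perfect_poly C)"

definition bar :: "bit poly \<Rightarrow> bit poly" where
  "bar Q = pcompose Q (X + 1)"

definition M1 :: "bit poly" where "M1 = 1 + X + X^2"
definition M2 :: "bit poly" where "M2 = 1 + X + X^3"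
definition M3 :: "bit poly" where "M3 = 1 + X^2 + X^3"
definition M4 :: "bit poly" where "M4 = 1 + X + X^2 + X^3 + X^4"
definition M5 :: "bit poly" where "M5 = 1 + X^3 + X^4"
definition M6 :: "bit poly" where "M6 = 1 + X^3 + X^5"
definition M7 :: "bit poly" where "M7 = 1 + X^3 + X^7"
definition M8 :: "bit poly" where "M8 = 1 + X^6 + X^7"
definition M9 :: "bit poly" where "M9 = bar M6"
definition M10 :: "bit poly" where "M10 = bar M7"
definition M11 :: "bit poly" where "M11 = bar M8"
definition M12 :: "bit poly" where "M12 = 1 + X + X^9"
definition M13 :: "bit poly" where "M13 = 1 + X^8 + X^9"

definition S1 :: "bit poly" where "S1 = 1 + X * (X + 1) * M1"
definition S2 :: "bit poly" where "S2 = 1 + X^2 * (X + 1)^2 * M1"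
definition S3 :: "bit poly" where "S3 = 1 + X * (X + 1)^3 * M1^4"
definition S4 :: "bit poly" where "S4 = 1 + X^3 * (X + 1) * M1"
definition S5 :: "bit poly" where "S5 = 1 + X * (X + 1)^3 * M1"
definition S6 :: "bit poly" where "S6 = 1 + X^3 * (X + 1) * M1^4"
definition S7 :: "bit poly" where "S7 = 1 + X * (X + 1) * M1^3"
definition S8 :: "bit poly" where "S8 = 1 + X^3 * (X + 1)^3 * M1"
definition S9 :: "bit poly" where "S9 = 1 + X * (X + 1) * M1^5"
definition S10 :: "bit poly" where "S10 = 1 + X^4 * (X + 1) * M1"
definition S11 :: "bit poly" where "S11 = 1 + X * (X + 1)^2 * M1"
definition S12 :: "bit poly" where "S12 = 1 + X^2 * (X + 1) * M1^2"
definition S13 :: "bit poly" where "S13 = 1 + X * (X + 1)^4 * M1"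
definition S14 :: "bit poly" where "S14 = 1 + X^2 * (X + 1) * M1"
definition S15 :: "bit poly" where "S15 = 1 + X * (X + 1)^2 * M1^2"

definition T1 :: "bit poly" where "T1 = X^2 * (X + 1) * M1"
definition T2 :: "bit poly" where "T2 = bar T1"
definition T3 :: "bit poly" where "T3 = X^4 * (X + 1)^3 * M4"
definition T4 :: "bit poly" where "T4 = bar T3"
definition T5 :: "bit poly" where "T5 = X^4 * (X + 1)^4 * M4 * bar M4"
definition T6 :: "bit poly" where "T6 = X^6 * (X + 1)^3 * M2 * bar M2"
definition T7 :: "bit poly" where "T7 = bar T6"
definition T8 :: "bit poly" where "T8 = X^4 * (X + 1)^6 * M2 * bar M2 * M4"
definition T9 :: "bit poly" where "T9 = bar T8"
definition T10 :: "bit poly" where "T10 = X^2 * (X + 1) * M1^2 * (1 + X + X^4)"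
definition T11 :: "bit poly" where "T11 = bar T10"

definition F_set :: "bit poly set" where
  "F_set = {M1, M2, M3, M4, M5, M6, M7, M8, M9, M10, M11, M12, M13,
            S1, S2, S3, S4, S5, S6, S7, S8, S9, S10, S11, S12, S13, S14, S15}"

definition T_set :: "bit poly set" where
  "T_set = {T1, T2, T3, T4, T5, T6, T7, T8, T9, T10, T11}"

end

theory Submission
  imports Defs "HOL-Computational_Algebra.Field_as_Ring" "HOL-Number_Theory.Cong"
    "HOL-Library.Code_Binary_Nat"
begin

text \<open>
  Write the exponent of an irreducible factor \<open>P\<close> of a perfect polynomial as \<open>N u - 1\<close> with \<open>N\<close> a power of two
  and \<open>u\<close> odd. In characteristic two, \<open>\<sigma>(P ^ (N u - 1)) = (1 + P) ^ (N - 1) (1 + P + \<dots> + P ^ (u - 1)) ^ N\<close>,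
  so all irreducible factors of \<open>1 + P + \<dots> + P ^ (u - 1)\<close> are admitted ones. If \<open>u\<close> is a prime, it divides
  \<open>2 ^ d - 1\<close> for the degree \<open>d\<close> of such a factor, which leaves finitely many primes; a prime or a composite
  \<open>u\<close> is excluded by a factor \<open>g\<close> of \<open>1 + X + \<dots> + X ^ (u - 1)\<close> such that \<open>g(P)\<close> has a foreign irreducible
  factor. So every \<open>P\<close> has finitely many possible \<open>u\<close>, and comparing the multiplicities of each irreducible
  in \<open>\<sigma>(A) = A\<close> gives equations that are linear in the powers of two \<open>N\<close>. A search with the \<open>N\<close> known only
  as \<open>1\<close>, \<open>2\<close> or a multiple of \<open>4\<close> leaves fourteen cases: the eleven polynomials \<open>T\<^sub>i\<close> and powers of
  \<open>x (x + 1)\<close>. All of these except \<open>1\<close> are divisible by \<open>x\<close>, so none is a product of two coprime ones.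
\<close>

section \<open>The ring of polynomials over the field with two elements\<close>

text \<open>These instances make \<open>bit poly\<close> a factorial Euclidean ring, which provides
  \<open>prime\<close>, \<open>multiplicity\<close> and \<open>prime_factors\<close>.\<close>

instantiation bit ::
  "{unique_euclidean_ring, normalization_euclidean_semiring, normalization_semidom_multiplicative}"
begin

definition [simp]: "normalize_bit = (normalize_field :: bit \<Rightarrow> _)"
definition [simp]: "unit_factor_bit = (unit_factor_field :: bit \<Rightarrow> _)"
definition [simp]: "euclidean_size_bit = (euclidean_size_field :: bit \<Rightarrow> _)"
definition [simp]: "division_segment (x :: bit) = 1"

instance
  by standard
    (simp_all add: dvd_field_iff field_split_simps split: if_splits)

end

instantiation bit :: euclidean_ring_gcd
begin

definition gcd_bit :: "bit \<Rightarrow> bit \<Rightarrow> bit" where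
  "gcd_bit = Euclidean_Algorithm.gcd"
definition lcm_bit :: "bit \<Rightarrow> bit \<Rightarrow> bit" where
  "lcm_bit = Euclidean_Algorithm.lcm"
definition Gcd_bit :: "bit set \<Rightarrow> bit" where
 "Gcd_bit = Euclidean_Algorithm.Gcd"
definition Lcm_bit :: "bit set \<Rightarrow> bit" where
 "Lcm_bit = Euclidean_Algorithm.Lcm"

instance by standard (simp_all add: gcd_bit_def lcm_bit_def Gcd_bit_def Lcm_bit_def)

end

instance bit :: field_gcd ..


lemma lead_coeff_bit_poly: "p \<noteq> 0 \<Longrightarrow> lead_coeff p = 1" for p :: "bit poly"
  by (metis bit_not_zero_iff leading_coeff_0_iff)

text \<open>Every nonzero leading coefficient is 1. So associated polynomials are equal, and the
  primes are exactly the irreducibles.\<close>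

lemma normalize_bit_poly [simp]: "normalize p = p" for p :: "bit poly"
proof (cases "p = 0")
  case False
  then have "unit_factor p = 1"
    by (simp add: unit_factor_poly_def lead_coeff_bit_poly one_pCons)
  then show ?thesis using unit_factor_mult_normalize[of p] by simp
qed simp

lemma prime_bit_poly_iff: "prime p \<longleftrightarrow> irreducible p" for p :: "bit poly"
  by (simp add: prime_def prime_elem_iff_irreducible)

lemma two_eq_0_bit_poly [simp]: "2 = (0 :: bit poly)"
  by (metis bit_2_eq_0 numeral_poly pCons_0_0)

lemma add_self_bit_poly [simp]: "p + p = 0" for p :: "bit poly"
  by (metis mult_2 mult_zero_left two_eq_0_bit_poly)

lemma add_add_self_bit_poly [simp]: "p + (p + q) = q" for p q :: "bit poly"
  by (metis add.assoc add_self_bit_poly add_0)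

lemma uminus_bit_poly [simp]: "- p = p" for p :: "bit poly"
  by (rule minus_unique) simp

lemma minus_bit_poly [simp]: "p - q = p + q" for p q :: "bit poly"
  by (metis uminus_bit_poly diff_conv_add_uminus)

lemma add_eq_0_bit_poly: "p + q = 0 \<longleftrightarrow> p = q" for p q :: "bit poly"
  by (metis add_self_bit_poly add_add_self_bit_poly add.right_neutral)

lemma bit_poly_unit: "is_unit p \<longleftrightarrow> p = 1" for p :: "bit poly"
  by (metis is_unit_normalize normalize_bit_poly is_unit_triv one_dvd dvd_refl)

section \<open>Multiplicativity of the divisor sum\<close>

lemma sigma_eq_sum_divisors: "A \<noteq> 0 \<Longrightarrow> sigma A = (\<Sum>D | D dvd A. D)"
  unfolding sigma_def by (rule sum.cong) (auto simp: lead_coeff_bit_poly)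

abbreviation geo :: "nat \<Rightarrow> bit poly \<Rightarrow> bit poly" where
  "geo n P \<equiv> (\<Sum>i<n. P ^ i)"

text \<open>Divisors of \<open>P ^ k * B\<close> correspond bijectively to pairs of an exponent
  \<open>i \<le> k\<close> and a divisor of \<open>B\<close>, so the divisor sum splits into a
  product.\<close>

lemma sigma_prime_power_mult:
  assumes P: "prime P" and B: "B \<noteq> 0" "\<not> P dvd B"
  shows "sigma (P ^ k * B) = geo (Suc k) P * sigma B"
proof -
  have P0: "P \<noteq> 0" "\<not> is_unit P" using P by (auto simp: prime_def prime_elem_def)
  let ?f = "\<lambda>(i, D). P ^ i * D"
  \<comment> \<open>The exponent is recovered as the multiplicity of \<open>P\<close>, since
    \<open>P\<close> divides no divisor of \<open>B\<close>.\<close>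
  have inj: "inj_on ?f ({..<Suc k} \<times> {D. D dvd B})"
  proof (rule inj_onI, clarsimp)
    fix i j D E assume D: "D dvd B" and E: "E dvd B" and eq: "P ^ i * D = P ^ j * E"
    have "\<not> P dvd D" "\<not> P dvd E" using D E B dvd_trans by blast+
    moreover have "D \<noteq> 0" "E \<noteq> 0" using D E B by auto
    ultimately have "multiplicity P (P ^ i * D) = i" "multiplicity P (P ^ j * E) = j"
      using P P0 by (auto simp: prime_elem_multiplicity_mult_distrib not_dvd_imp_multiplicity_0)
    with eq have "i = j" by simp
    with eq P0 show "i = j \<and> D = E" by auto
  qed
  have img: "?f ` ({..<Suc k} \<times> {D. D dvd B}) = {D. D dvd P ^ k * B}"
  proof (intro set_eqI iffI)
    fix D assume "D \<in> ?f ` ({..<Suc k} \<times> {D. D dvd B})"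
    then show "D \<in> {D. D dvd P ^ k * B}" by (auto intro!: mult_dvd_mono le_imp_power_dvd)
  next
    fix D assume "D \<in> {D. D dvd P ^ k * B}"
    then have D: "D dvd P ^ k * B" by simp
    then have D0: "D \<noteq> 0" using B P0 by auto
    obtain E where E: "D = P ^ multiplicity P D * E" "\<not> P dvd E"
      using multiplicity_decompose'[of D P] D0 P0 by blast
    have "coprime E (P ^ k)"
      using E P by (metis coprime_commute coprime_power_left_iff prime_imp_coprime)
    moreover have "E dvd P ^ k * B" using D E by (metis dvd_mult_right)
    ultimately have "E dvd B" by (simp add: coprime_dvd_mult_right_iff)
    moreover have "multiplicity P D \<le> multiplicity P (P ^ k * B)"
      using D B P0 by (intro dvd_imp_multiplicity_le) auto
    then have "multiplicity P D < Suc k"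
      using B P P0 by (auto simp: prime_elem_multiplicity_mult_distrib not_dvd_imp_multiplicity_0)
    ultimately show "D \<in> ?f ` ({..<Suc k} \<times> {D. D dvd B})" using E(1) by force
  qed
  have "sigma (P ^ k * B) = sum (\<lambda>D. D) (?f ` ({..<Suc k} \<times> {D. D dvd B}))"
    using B P0 by (subst sigma_eq_sum_divisors) (simp_all add: img)
  also have "\<dots> = (\<Sum>(i, D)\<in>{..<Suc k} \<times> {D. D dvd B}. P ^ i * D)"
    by (subst sum.reindex[OF inj]) (simp add: case_prod_unfold)
  also have "\<dots> = geo (Suc k) P * (\<Sum>D | D dvd B. D)"
    by (simp only: sum_product sum.cartesian_product)
  also have "\<dots> = geo (Suc k) P * sigma B"
    using B by (simp add: sigma_eq_sum_divisors)
  finally show ?thesis .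
qed

lemma sigma_1 [simp]: "sigma 1 = 1"
  by (simp add: sigma_eq_sum_divisors bit_poly_unit)

lemma sigma_prod_prime_powers:
  assumes "finite S" "\<And>P. P \<in> S \<Longrightarrow> prime P"
  shows "sigma (\<Prod>P\<in>S. P ^ e P) = (\<Prod>P\<in>S. geo (Suc (e P)) P)"
  using assms
proof (induction S rule: finite_induct)
  case (insert Q S)
  have "\<not> Q dvd (\<Prod>P\<in>S. P ^ e P)"
  proof
    assume "Q dvd (\<Prod>P\<in>S. P ^ e P)"
    then obtain P where "P \<in> S" "Q dvd P ^ e P"
      using insert by (auto simp: prime_dvd_prod_iff)
    then have "Q = P" using insert.prems by (metis insertCI prime_dvd_power primes_dvd_imp_eq)
    then show False using \<open>P \<in> S\<close> insert.hyps by simp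
  qed
  moreover have "(\<Prod>P\<in>S. P ^ e P) \<noteq> 0"
  proof -
    have "P \<noteq> 0" if "P \<in> S" for P using insert.prems that by (metis insertCI not_prime_0)
    then show ?thesis using insert.hyps by simp
  qed
  ultimately show ?case using insert by (simp add: sigma_prime_power_mult del: sum.lessThan_Suc)
qed auto

section \<open>Frobenius and geometric sums in characteristic two\<close>

lemma frobenius_bit_poly: "(p + q) ^ 2 ^ n = p ^ 2 ^ n + q ^ 2 ^ n" for p q :: "bit poly"
proof (induction n)
  case (Suc n)
  have "(p + q) ^ 2 ^ Suc n = ((p + q) ^ 2 ^ n) ^ 2" by (simp add: mult.commute flip: power_mult)
  also have "\<dots> = (p ^ 2 ^ n) ^ 2 + (q ^ 2 ^ n) ^ 2" by (simp add: Suc power2_sum)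
  finally show ?case by (simp add: mult.commute flip: power_mult)
qed simp

lemma geo_times: "(1 + P) * geo n P = 1 + P ^ n"
  using one_diff_power_eq[of P n] by simp

text \<open>Multiplied by \<open>1 + P\<close>, both sides become \<open>1 + P ^ (2 ^ n * u)\<close>
  by Frobenius; \<open>P \<noteq> 1\<close> allows the cancellation.\<close>

lemma geo_pow2_mult:
  assumes "P \<noteq> 1"
  shows "geo (2 ^ n * u) P = (1 + P) ^ (2 ^ n - 1) * geo u P ^ 2 ^ n"
proof -
  have "(1 + P) * geo (2 ^ n * u) P = 1 ^ 2 ^ n + (P ^ u) ^ 2 ^ n"
    by (simp add: geo_times power_mult mult.commute)
  also have "\<dots> = ((1 + P) * geo u P) ^ 2 ^ n"
    by (simp only: frobenius_bit_poly geo_times)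
  also have "\<dots> = (1 + P) ^ Suc (2 ^ n - 1) * geo u P ^ 2 ^ n"
    by (subst Suc_diff_1) (simp_all add: power_mult_distrib)
  also have "\<dots> = (1 + P) * ((1 + P) ^ (2 ^ n - 1) * geo u P ^ 2 ^ n)"
    by (simp only: power_Suc mult.assoc)
  finally have "(1 + P) * geo (2 ^ n * u) P = (1 + P) * ((1 + P) ^ (2 ^ n - 1) * geo u P ^ 2 ^ n)" .
  moreover have "1 + P \<noteq> 0" using assms by (metis add_eq_0_bit_poly)
  ultimately show ?thesis by simp
qed

text \<open>Frobenius is additive and fixes the coefficients 0 and 1, so it acts on the variable
  alone.\<close>

lemma power_two_power_bit_poly: "P ^ 2 ^ d = pcompose P (X ^ 2 ^ d)" for P :: "bit poly"
proof (induction P)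
  case (pCons a p)
  have "pCons a p = [:a:] + X * p" by simp
  then have "pCons a p ^ 2 ^ d = [:a:] ^ 2 ^ d + X ^ 2 ^ d * p ^ 2 ^ d"
    by (simp only: frobenius_bit_poly power_mult_distrib)
  also have "[:a:] ^ 2 ^ d = [:a:]" by (cases a) (auto simp flip: one_pCons simp: power_0_left)
  finally show ?case using pCons by (simp add: pcompose_pCons)
qed (simp add: power_0_left)

text \<open>Substitution respects congruence modulo \<open>Q\<close>; differences are written as
  sums in characteristic two.\<close>

lemma dvd_pcompose_add:
  fixes P :: "bit poly" assumes "Q dvd R + S" shows "Q dvd pcompose P R + pcompose P S"
proof (induction P)
  case (pCons a p)
  have "pcompose (pCons a p) R + pcompose (pCons a p) S =
      (R + S) * pcompose p R + S * (pcompose p R + pcompose p S)"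
    by (simp add: pcompose_pCons algebra_simps)
  then show ?case using pCons assms by (metis dvd_add dvd_mult dvd_mult2)
qed simp

text \<open>Fermat's little theorem in the field with \<open>2 ^ d\<close> elements \<open>\<bbbF>\<^sub>2[x]/(Q)\<close>.\<close>
lemma dvd_geo_prime_imp:
  assumes Q: "prime Q" and frob: "Q dvd X ^ 2 ^ d + X"
    and p: "prime p" "odd p" and dvd: "Q dvd geo p P"
  shows "p dvd 2 ^ d - 1"
proof (rule ccontr)
  define m :: nat where "m = 2 ^ d - 1"
  have m: "2 ^ d = Suc m" by (simp add: m_def)
  assume "\<not> p dvd 2 ^ d - 1"
  \<comment> \<open>Modulo \<open>Q\<close> both \<open>P ^ p\<close> and \<open>P ^ m\<close> will
    be 1, and coprime exponents then force \<open>P\<close> to be 1.\<close>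
  then have "coprime p m" using p prime_imp_coprime m_def by blast
  then obtain a b where ab: "a * p = b * m + 1"
    using bezout_nat[of p m] p by (metis coprime_imp_gcd_eq_1 mult.commute not_prime_0)
  have Pp: "[P ^ p = 1] (mod Q)"
    using dvd geo_times[of P p] by (metis add.commute cong_iff_dvd_diff dvd_mult minus_bit_poly)
  have nQP: "\<not> Q dvd P"
  proof
    assume "Q dvd P"
    then have "Q dvd P ^ p" using p by (intro dvd_trans[OF _ dvd_power]) (auto simp: prime_gt_0_nat)
    then have "Q dvd 1" using Pp by (metis cong_dvd_iff)
    then show False using Q by auto
  qed
  have "Q dvd P ^ 2 ^ d + P"
    using dvd_pcompose_add[OF frob, of P] by (simp add: power_two_power_bit_poly[of P])
  then have "Q dvd P * (P ^ m + 1)" by (simp add: m algebra_simps)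
  then have "Q dvd P ^ m + 1" using nQP Q prime_dvd_mult_iff by blast
  then have Pm: "[P ^ m = 1] (mod Q)" by (simp add: cong_iff_dvd_diff)
  have "[P ^ (a * p) = 1] (mod Q)"
    using cong_pow[OF Pp, of a] by (simp add: power_mult[symmetric] mult.commute)
  moreover have "[P ^ (b * m + 1) = P] (mod Q)"
    using cong_mult[OF cong_pow[OF Pm, of b] cong_refl[of P]]
    by (simp add: power_mult[symmetric] mult.commute)
  ultimately have P1: "[P = 1] (mod Q)" using ab by (metis cong_sym cong_trans)
  have "[geo p P = geo p 1] (mod Q)"
    by (intro cong_sum cong_pow P1)
  \<comment> \<open>The sum consists of \<open>p\<close> ones, and \<open>p\<close> is odd.\<close>
  also have "geo p 1 = 1" using p(2) by (auto elim!: oddE)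
  finally have "Q dvd 1" using dvd by (metis cong_dvd_iff)
  then show False using Q by auto
qed

lemma geo_dvd_geo: "m dvd n \<Longrightarrow> m > 0 \<Longrightarrow> P \<noteq> 1
  \<Longrightarrow> geo m P dvd geo n P"
proof (elim dvdE)
  fix k assume "m > 0" "P \<noteq> 1" "n = m * k"
  have "(1 + P) * geo n P = (1 + P ^ m) * geo k (P ^ m)"
    using \<open>n = m * k\<close> by (simp add: geo_times power_mult)
  also have "\<dots> = (1 + P) * (geo m P * geo k (P ^ m))" by (simp flip: geo_times add:
    mult.assoc)
  finally have "geo n P = geo m P * geo k (P ^ m)"
    using \<open>P \<noteq> 1\<close> by (metis add_eq_0_bit_poly mult_cancel_left)
  then show ?thesis by simp
qed

lemma pcompose_power: "pcompose (p ^ n) q = pcompose p q ^ n" for p :: "'a :: comm_ring_1 poly"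
  by (induction n) (simp_all add: pcompose_mult pcompose_1)

text \<open>Turns a divisor \<open>g\<close> of \<open>geo u X\<close> into the divisor
  \<open>g(P)\<close> of \<open>geo u P\<close>, the form of all refutations below.\<close>

lemma pcompose_geo_X: "pcompose (geo n X) P = geo n P"
  by (induction n) (simp_all add: pcompose_add pcompose_power pcompose_pCons)

lemma dvd_pcompose: "p dvd q \<Longrightarrow> pcompose p r dvd pcompose q r" for p :: "'a ::
  comm_ring_1 poly"
  by (auto simp: pcompose_mult elim!: dvdE)

section \<open>Computing with coefficient lists\<close>

text \<open>The leading coefficient comes first; superfluous leading zeros are allowed.\<close>

fun pol :: "bool list \<Rightarrow> bit poly" where
  "pol [] = 0"
| "pol (b # bs) = monom (of_bool b) (length bs) + pol bs"

lemma pol_append: "pol (as @ bs) = pol as * X ^ length bs + pol bs"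
  by (induction as) (simp_all add: algebra_simps monom_altdef power_add)

lemma pol_replicate_False [simp]: "pol (replicate n False) = 0"
  by (induction n) simp_all

lemma coeff_pol: "coeff (pol bs) i = of_bool (i < length bs \<and> rev bs ! i)"
  by (induction bs) (auto simp: nth_append less_Suc_eq)

lemma degree_pol_less: "bs \<noteq> [] \<Longrightarrow> degree (pol bs) < length bs"
  by (rule degree_lessI) (auto simp: coeff_pol)

fun has_bit :: "bool list \<Rightarrow> bool" where
  "has_bit [] = False"
| "has_bit (True # bs) = True"
| "has_bit (False # bs) = has_bit bs"

lemma has_bit_iff: "has_bit bs \<longleftrightarrow> True \<in> set bs"
  by (induction bs rule: has_bit.induct) auto

lemma pol_eq_0_iff: "pol bs = 0 \<longleftrightarrow> \<not> has_bit bs"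
proof -
  have "pol bs = 0 \<longleftrightarrow> (\<forall>i<length (rev bs). \<not> rev bs ! i)"
    by (auto simp: poly_eq_iff coeff_pol)
  also have "\<dots> \<longleftrightarrow> True \<notin> set (rev bs)" by (metis (full_types)
    in_set_conv_nth)
  finally show ?thesis by (simp add: has_bit_iff)
qed

fun trim :: "bool list \<Rightarrow> bool list" where
  "trim (False # bs) = trim bs"
| "trim bs = bs"

lemma pol_trim [simp]: "pol (trim bs) = pol bs"
  by (induction bs rule: trim.induct) simp_all

fun nonconst :: "bool list \<Rightarrow> bool" where
  "nonconst [] = False"
| "nonconst [b] = False"
| "nonconst (True # b # bs) = True"
| "nonconst (False # b # bs) = nonconst (b # bs)"

lemma nonconstD: "nonconst bs \<Longrightarrow> pol bs \<noteq> 0 \<and> pol bs \<noteq> 1"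
proof -
  assume "nonconst bs"
  then have "\<exists>i>0. i < length bs \<and> rev bs ! i"
  proof (induction bs rule: nonconst.induct)
    case (3 b bs)
    show ?case by (rule exI[of _ "Suc (length bs)"]) (simp add: nth_append)
  next
    case (4 b bs)
    then obtain i where "i > 0" "i < length (b # bs)" "rev (b # bs) ! i" by auto
    then show ?case by (intro exI[of _ i]) (auto simp: nth_append less_Suc_eq)
  qed simp_all
  then obtain i where "i > 0" "coeff (pol bs) i = 1" by (auto simp: coeff_pol)
  then show ?thesis by auto
qed

text \<open>The divisor \<open>True # q\<close> is represented by its tail \<open>q\<close>; \<open>r\<close> is the running remainder.\<close>

fun add_shift :: "bool list \<Rightarrow> bool list \<Rightarrow> bool \<Rightarrow> bool list"
  where
  "add_shift [] r b = []"
| "add_shift [True] r b = [\<not> b]"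
| "add_shift [False] r b = [b]"
| "add_shift (True # q) (a # r) b = (\<not> a) # add_shift q r b"
| "add_shift (False # q) (a # r) b = a # add_shift q r b"
| "add_shift q [] b = []"

fun shift :: "bool list \<Rightarrow> bool \<Rightarrow> bool list" where
  "shift [] b = [b]"
| "shift (a # r) b = a # shift r b"

section \<open>Long division\<close>

fun rem :: "bool list \<Rightarrow> bool list \<Rightarrow> bool list \<Rightarrow> bool list" where
  "rem q (True # r) (b # bs) = rem q (add_shift q r b) bs"
| "rem q (False # r) (b # bs) = rem q (shift r b) bs"
| "rem q r [] = r"
| "rem q [] bs = []"

fun quot :: "bool list \<Rightarrow> bool list \<Rightarrow> bool list \<Rightarrow> bool list"
  where
  "quot q (True # r) (b # bs) = True # quot q (add_shift q r b) bs"
| "quot q (False # r) (b # bs) = False # quot q (shift r b) bs"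
| "quot q r [] = []"
| "quot q [] bs = []"

lemma shift_eq: "shift r b = r @ [b]"
  by (induction r) simp_all

lemma add_shift:
  "length q = Suc (length r) \<Longrightarrow>
    length (add_shift q r b) = length q \<and> pol (add_shift q r b) = pol q + pol (r @ [b])"
proof (induction q r b rule: add_shift.induct)
  case ("4" v va a r b)
  then show ?case by (cases a) (simp_all add: algebra_simps flip: add_monom)
next
  case ("5" v va a r b)
  then show ?case by (simp add: algebra_simps)
qed (simp_all add: one_pCons monom_0)

text \<open>Invariant of long division: the window \<open>r\<close> keeps the length of the
  divisor's tail, and each step shifts in the next coefficient of the dividend.\<close>

lemma quot_rem:
  "length r = length q \<Longrightarrow> q \<noteq> [] \<Longrightarrow>
    length (rem q r bs) = length q \<and> length (quot q r bs) = length bs \<and>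
    pol (r @ bs) = pol (True # q) * pol (quot q r bs) + pol (rem q r bs)"
proof (induction q r bs rule: rem.induct)
  case (1 q r b bs)
  have l: "length q = Suc (length r)" using 1 by simp
  have "pol ((True # r) @ b # bs) = pol (True # r @ [b]) * X ^ length bs + pol bs"
    by (metis append.assoc append_Cons append_Nil pol_append)
  \<comment> \<open>The window starts with \<open>True\<close>, so adding the divisor cancels its
    leading term.\<close>
  also have "pol (True # r @ [b]) = pol (True # q) + pol (add_shift q r b)"
    using add_shift[OF l, of b] l by (simp add: algebra_simps)
  finally have "pol ((True # r) @ b # bs) =
      pol (True # q) * X ^ length bs + pol (add_shift q r b @ bs)"
    by (simp only: pol_append algebra_simps)
  moreover have "pol (quot q (True # r) (b # bs)) = X ^ length bs + pol (quot q (add_shift q r b)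
    bs)"
    using 1 add_shift[OF l, of b] l by (simp add: monom_altdef)
  ultimately show ?case using 1 add_shift[OF l, of b] l
    by (simp only: algebra_simps) auto
next
  case (2 q r b bs)
  then show ?case by (simp add: shift_eq)
qed auto

fun zeros :: "bool list \<Rightarrow> bool list" where
  "zeros [] = []"
| "zeros (b # bs) = False # zeros bs"

lemma zeros [simp]: "length (zeros bs) = length bs" "pol (zeros bs) = 0"
  by (induction bs) simp_all

fun divides :: "bool list \<Rightarrow> bool list \<Rightarrow> bool" where
  "divides (True # q) f = (\<not> has_bit (rem q (zeros q) f))"
| "divides q f = False"

text \<open>A second entry forces positive degree: with an empty tail the window would be empty and
  \<open>quot\<close> would stop at once.\<close>

fun monic_list :: "bool list \<Rightarrow> bool" where
  "monic_list (True # b # q) = True"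
| "monic_list q = False"

lemma monic_listE:
  assumes "monic_list Q" obtains q where "Q = True # q" "q \<noteq> []"
  using assms by (cases Q rule: monic_list.cases) auto

lemma degree_monic_list: "monic_list Q \<Longrightarrow> degree (pol Q) = length Q - 1"
proof (elim monic_listE)
  fix q assume "Q = True # q" "q \<noteq> []"
  then have "degree (pol Q) \<le> length Q - 1" "coeff (pol Q) (length Q - 1) \<noteq> 0"
    using degree_pol_less[of Q] by (auto simp: coeff_pol nth_append)
  then show ?thesis by (meson le_antisym le_degree)
qed

text \<open>The remainder has smaller degree than the divisor, so it is a multiple of the divisor
  only if it is 0.\<close>

lemma divides_iff:
  assumes "monic_list Q" shows "divides Q f \<longleftrightarrow> pol Q dvd pol f"
proof -
  obtain q where q: "Q = True # q" "q \<noteq> []" using assms by (rule monic_listE)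
  let ?r = "rem q (zeros q) f"
  have r: "length ?r = length q" "pol f = pol Q * pol (quot q (zeros q) f) + pol ?r"
    using quot_rem[of "zeros q" q f] q by (auto simp: pol_append)
  have "pol Q dvd pol f \<longleftrightarrow> pol Q dvd pol ?r"
    unfolding r(2) by (simp add: dvd_add_right_iff)
  also have "\<dots> \<longleftrightarrow> pol ?r = 0"
    using degree_pol_less[of ?r] degree_monic_list[OF assms] r(1) q
    by (metis dvd_0_right dvd_imp_degree_le length_0_conv length_Cons diff_Suc_1 not_less)
  finally show ?thesis using q by (simp add: pol_eq_0_iff)
qed

fun cofactor :: "bool list \<Rightarrow> bool list \<Rightarrow> bool \<Rightarrow> bool list" where
  "cofactor (True # q) f True = quot q (zeros q) f"
| "cofactor q f b = f"

text \<open>Removes at most one factor \<open>Q\<close>. This is sound because the result is a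
  divisor in any case, and \<open>refuted\<close> tests afterwards that no member of the base
  divides what is left.\<close>

definition strip :: "bool list \<Rightarrow> bool list \<Rightarrow> bool list" where
  "strip Q f = cofactor Q f (divides Q f)"

lemma strip_dvd: "monic_list Q \<Longrightarrow> pol (strip Q f) dvd pol f"
proof -
  assume Q: "monic_list Q"
  then obtain q where q: "Q = True # q" "q \<noteq> []" by (rule monic_listE)
  show ?thesis
  proof (cases "divides Q f")
    case True
    then have "pol f = pol Q * pol (quot q (zeros q) f)"
      using quot_rem[of "zeros q" q f] q by (auto simp: pol_append simp flip: pol_eq_0_iff)
    then show ?thesis using True q by (simp add: strip_def)
  qed (use q in \<open>simp add: strip_def\<close>)
qed

lemma fold_strip_dvd: "list_all monic_list Qs \<Longrightarrow> pol (fold strip Qs f) dvd pol f"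
  by (induction Qs arbitrary: f) (auto intro: dvd_trans strip_dvd)

text \<open>Both arguments are aligned at their leading ends.\<close>
fun add_top :: "bool list \<Rightarrow> bool list \<Rightarrow> bool list" where
  "add_top [] bs = bs"
| "add_top as [] = []"
| "add_top (True # as) (b # bs) = (\<not> b) # add_top as bs"
| "add_top (False # as) (b # bs) = b # add_top as bs"

lemma add_top:
  "length as \<le> length bs \<Longrightarrow> length (add_top as bs) = length bs \<and>
    pol (add_top as bs) = pol as * X ^ (length bs - length as) + pol bs"
proof (induction as bs rule: add_top.induct)
  case (3 as b bs)
  then show ?case by (cases b) (simp_all add: algebra_simps monom_altdef flip: power_add)
next
  case (4 as b bs)
  then show ?case by (simp add: algebra_simps)
qed auto

section \<open>Multiplication and substitution\<close>

fun mul :: "bool list \<Rightarrow> bool list \<Rightarrow> bool list" where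
  "mul [] bs = zeros bs"
| "mul (True # as) bs = False # add_top bs (mul as bs)"
| "mul (False # as) bs = False # mul as bs"

lemma mul: "length (mul as bs) = length as + length bs \<and> pol (mul as bs) = pol as * pol bs"
proof (induction as bs rule: mul.induct)
  case (2 as bs)
  then show ?case
    using add_top[of bs "mul as bs"] by (simp add: algebra_simps monom_altdef)
qed simp_all

lemma pol_mul [simp]: "pol (mul as bs) = pol as * pol bs"
  by (simp add: mul)

fun flip_last :: "bool list \<Rightarrow> bool list" where
  "flip_last [] = [True]"
| "flip_last [b] = [\<not> b]"
| "flip_last (b # c # bs) = b # flip_last (c # bs)"

lemma length_flip_last: "bs \<noteq> [] \<Longrightarrow> length (flip_last bs) = length bs"
  by (induction bs rule: flip_last.induct) auto

lemma pol_flip_last [simp]: "pol (flip_last bs) = 1 + pol bs"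
proof (induction bs rule: flip_last.induct)
  case (2 b) show ?case by (cases b) (simp_all add: one_pCons monom_0)
qed (auto simp: length_flip_last algebra_simps one_pCons monom_0)

fun comp :: "bool list \<Rightarrow> bool list \<Rightarrow> bool list \<Rightarrow> bool list"
  where
  "comp acc [] P = acc"
| "comp acc (True # bs) P = comp (flip_last (mul acc P)) bs P"
| "comp acc (False # bs) P = comp (mul acc P) bs P"

text \<open>Horner's scheme: each coefficient read multiplies the accumulator by \<open>P\<close>
  and adds 1 if it is set.\<close>

lemma pol_comp: "pol (comp acc bs P) = pol acc * pol P ^ length bs + pcompose (pol bs) (pol P)"
proof (induction acc bs P rule: comp.induct)
  case (2 acc bs P)
  have "pcompose (monom (1 :: bit) n) Q = Q ^ n" for n Q
    by (induction n) (simp_all add: monom_Suc pcompose_pCons one_pCons monom_0)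
  with 2 show ?case by (simp add: pcompose_add algebra_simps)
qed (simp_all add: algebra_simps)

definition geo_list :: "nat \<Rightarrow> bool list \<Rightarrow> bool list" where
  "geo_list n P = comp [] (replicate n True) P"

lemma pol_replicate_True: "pol (replicate n True) = geo n X"
  by (induction n) (simp_all add: monom_altdef add.commute)

lemma pol_geo_list [simp]: "pol (geo_list n P) = geo n (pol P)"
  by (simp add: geo_list_def pol_comp pol_replicate_True pcompose_geo_X)

fun mul_list :: "bool list list \<Rightarrow> bool list" where
  "mul_list [] = [True]"
| "mul_list (P # Ps) = mul P (mul_list Ps)"

lemma pol_mul_list [simp]: "pol (mul_list Ps) = (\<Prod>P\<leftarrow>Ps. pol P)"
  by (induction Ps) (simp_all add: one_pCons monom_0)

section \<open>The irreducible factors and their certificates\<close>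

definition "px = [True, False]"
definition "s3 = [True, True, True, True, True, True, True, True, True, True, True, True, True]"
definition "s4 = [True, False, False, True, False, False, True]"
definition "py = [True, True]"
definition "s5 = [True, False, True, True, False, True, True]"
definition "s6 = [True, True, False, False, True, True, False, False, True, True, False, False,
  True]"
definition "s8 = [True, False, True, True, False, True, False, False, True]"
definition "m1 = [True, True, True]"
definition "s2 = [True, True, False, True, True, False, True]"
definition "s1 = [True, False, False, True, True]"
definition "m2 = [True, False, True, True]"
definition "s7 = [True, False, True, True, True, True, False, True, True]"
definition "m3 = [True, True, False, True]"
definition "m4 = [True, True, True, True, True]"
definition "m5 = [True, True, False, False, True]"
definition "m6 = [True, False, True, False, False, True]"
definition "m7 = [True, False, False, False, True, False, False, True]"
definition "m8 = [True, True, False, False, False, False, False, True]"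
definition "m9 = [True, True, True, True, False, True]"
definition "m10 = [True, True, True, True, False, False, False, True]"
definition "m11 = [True, False, True, False, True, False, True, True]"
definition "m12 = [True, False, False, False, False, False, False, False, True, True]"
definition "m13 = [True, True, False, False, False, False, False, False, False, True]"
definition "s9 = [True, False, False, True, True, False, False, True, True, False, False, True,
  True]"
definition "s10 = [True, False, False, True, False, False, False, True]"
definition "s11 = [True, True, False, True, True, True]"
definition "s12 = [True, True, True, True, True, True, False, True]"
definition "s13 = [True, True, True, False, True, True, True, True]"
definition "s14 = [True, False, False, True, False, True]"
definition "s15 = [True, False, False, False, False, False, True, True]"

text \<open>The order is that in which the search below assigns the unknown exponents.\<close>

definition "factor_base = [px, s3, s4, py, s5, s6, s8, m1, s2, s1, m2, s7, m3, m4, m5, m6, m7, m8,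
  m9, m10, m11, m12, m13, s9, s10, s11, s12, s13, s14, s15]"

text \<open>The number in a name is the \<open>u\<close> for which the polynomial divides
  \<open>1 + X + ... + X ^ (u - 1)\<close>; letters separate different factors. For
  \<open>u = p * m\<close> among 9, 25, 27, 49 and 169, a factor for the prime \<open>p\<close> is
  evaluated at \<open>X ^ m\<close>, which works because
  \<open>geo u X = geo m X * geo p (X ^ m)\<close>; \<open>trim\<close> then restores a leading
  \<open>True\<close>.\<close>

definition "c3 = [True, True, True]"
definition "c5 = [True, True, True, True, True]"
definition "c7a = [True, False, True, True]"
definition "c7b = [True, True, False, True]"
definition "c9 = trim (comp [] c3 (True # replicate 3 False))"
definition "c13 = [True, True, True, True, True, True, True, True, True, True, True, True, True]"
definition "c17a = [True, False, False, True, True, True, False, False, True]"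
definition "c17b = [True, True, True, False, True, False, True, True, True]"
definition "c21 = [True, False, True, False, True, True, True]"
definition "c25 = trim (comp [] c5 (True # replicate 5 False))"
definition "c27 = trim (comp [] c3 (True # replicate 9 False))"
definition "c31a = [True, False, True, True, True, True]"
definition "c31b = [True, False, False, True, False, True]"
definition "c31c = [True, False, True, False, False, True]"
definition "c35 = [True, False, True, True, True, True, False, False, True, False, True, True,
  True]"
definition "c39 = [True, False, True, True, True, True, False, False, False, True, True, True,
  True]"
definition "c45 = [True, False, False, False, False, False, False, False, False, True, False,
  False, True]"
definition "c49 = trim (comp [] c7a (True # replicate 7 False))"
definition "c65 = [True, False, False, False, True, True, True, True, True, False, False, False,
  True]"
definition "c73a = [True, False, False, False, False, True, False, True, True, True]"
definition "c73b = [True, False, False, False, False, False, False, False, True, True]"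
definition "c91 = [True, False, False, False, True, False, True, True, True, True, False, False,
  True]"
definition "c127a = [True, False, False, False, True, True, True, True]"
definition "c127b = [True, False, False, False, False, False, True, True]"
definition "c127c = [True, False, False, False, True, False, False, True]"
definition "c127d = [True, False, False, True, True, True, False, True]"
definition "c169 = trim (comp [] c13 (True # replicate 13 False))"

text \<open>An entry \<open>(P, fs, us, bad)\<close> lists the irreducible factors \<open>fs\<close> of \<open>1 + P\<close>; the pairs \<open>(u, ds)\<close> in \<open>us\<close>
  with \<open>u\<close> odd and \<open>ds\<close> the factors of \<open>1 + P + \<dots> + P ^ (u - 1)\<close>; and pairs \<open>(u, g)\<close> in \<open>bad\<close> where \<open>g\<close> divides
  \<open>1 + X + \<dots> + X ^ (u - 1)\<close> and \<open>g(P)\<close> has an irreducible factor outside \<open>factor_base\<close>.\<close>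

definition table :: "(bool list \<times> bool list list \<times> (nat \<times> bool list list)
  list \<times> (nat \<times> bool list) list) list" where
  "table = [
    (px, [py], [(1, []), (3, [m1]), (5, [m4]), (7, [m2, m3]), (9, [m1, s4]), (13, [s3]), (15, [m1,
      m4, m5, s1])],
      [(17, c17a), (31, c31a), (73, c73a), (127, c127a), (21, c21), (39, c39), (25, c25), (35,
        c35), (65, c65), (49, c49), (91, c91), (169, c169), (27, c27), (45, c45)]),
    (s3, [px, py, py, py, m1, m1, m1, m1], [(1, [])],
      [(3, c3), (5, c5), (7, c7a), (13, c13), (17, c17a), (31, c31b), (73, c73b), (127, c127b)]),
    (s4, [px, px, px, py, m1], [(1, [])],
      [(3, c3), (5, c5), (7, c7a), (13, c13), (17, c17b), (31, c31b), (73, c73b), (127, c127b)]),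
    (py, [px], [(1, []), (3, [m1]), (5, [m5]), (7, [m2, m3]), (9, [m1, s5]), (13, [s6]), (15, [m1,
      m4, m5, s1])],
      [(17, c17a), (31, c31a), (73, c73a), (127, c127a), (21, c21), (39, c39), (25, c25), (35,
        c35), (65, c65), (49, c49), (91, c91), (169, c169), (27, c27), (45, c45)]),
    (s5, [px, py, py, py, m1], [(1, [])],
      [(3, c3), (5, c5), (7, c7a), (13, c13), (17, c17b), (31, c31b), (73, c73b), (127, c127b)]),
    (s6, [px, px, px, py, m1, m1, m1, m1], [(1, [])],
      [(3, c3), (5, c5), (7, c7a), (13, c13), (17, c17a), (31, c31b), (73, c73b), (127, c127b)]),
    (s8, [px, px, px, py, py, py, m1], [(1, [])],
      [(3, c3), (5, c5), (7, c7b), (13, c13), (17, c17a), (31, c31b), (73, c73b), (127, c127b)]),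
    (m1, [px, py], [(1, []), (3, [s1]), (5, [s8]), (7, [m2, m3, s2]), (15, [m4, m5, s1, s7, s8])],
      [(13, c13), (17, c17a), (31, c31b), (73, c73b), (127, c127b), (9, c9), (21, c21), (25, c25),
        (35, c35), (49, c49)]),
    (s2, [px, px, py, py, m1], [(1, []), (3, [s1, s7])],
      [(5, c5), (7, c7b), (13, c13), (17, c17a), (31, c31c), (73, c73b), (127, c127b), (9, c9)]),
    (s1, [px, py, m1], [(1, []), (3, [m4, m5])],
      [(5, c5), (7, c7a), (13, c13), (17, c17a), (31, c31b), (73, c73b), (127, c127b), (9, c9)]),
    (m2, [px, py, py], [(1, []), (3, [m1, m5])],
      [(5, c5), (7, c7b), (13, c13), (17, c17a), (31, c31a), (73, c73b), (127, c127c), (9, c9)]),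
    (s7, [px, py, m1, m1, m1], [(1, [])],
      [(3, c3), (5, c5), (7, c7b), (13, c13), (17, c17a), (31, c31b), (73, c73b), (127, c127b)]),
    (m3, [px, px, py], [(1, []), (3, [m1, m4])],
      [(5, c5), (7, c7b), (13, c13), (17, c17a), (31, c31a), (73, c73b), (127, c127c), (9, c9)]),
    (m4, [px, py, py, py], [(1, [])],
      [(3, c3), (5, c5), (7, c7b), (13, c13), (17, c17a), (31, c31b), (73, c73b), (127, c127b)]),
    (m5, [px, px, px, py], [(1, [])],
      [(3, c3), (5, c5), (7, c7b), (13, c13), (17, c17a), (31, c31b), (73, c73b), (127, c127b)]),
    (m6, [px, px, px, py, py], [(1, [])],
      [(3, c3), (5, c5), (7, c7a), (13, c13), (17, c17a), (31, c31c), (73, c73b), (127, c127b)]),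
    (m7, [px, px, px, py, py, py, py], [(1, [])],
      [(3, c3), (5, c5), (7, c7a), (13, c13), (17, c17a), (31, c31b), (73, c73b), (127, c127c)]),
    (m8, [px, px, px, px, px, px, py], [(1, [])],
      [(3, c3), (5, c5), (7, c7a), (13, c13), (17, c17a), (31, c31b), (73, c73b), (127, c127b)]),
    (m9, [px, px, py, py, py], [(1, [])],
      [(3, c3), (5, c5), (7, c7a), (13, c13), (17, c17a), (31, c31c), (73, c73b), (127, c127b)]),
    (m10, [px, px, px, px, py, py, py], [(1, [])],
      [(3, c3), (5, c5), (7, c7a), (13, c13), (17, c17a), (31, c31b), (73, c73b), (127, c127c)]),
    (m11, [px, py, py, py, py, py, py], [(1, [])],
      [(3, c3), (5, c5), (7, c7a), (13, c13), (17, c17a), (31, c31b), (73, c73b), (127, c127b)]),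
    (m12, [px, py, py, py, py, py, py, py, py], [(1, [])],
      [(3, c3), (5, c5), (7, c7a), (13, c13), (17, c17a), (31, c31c), (73, c73b), (127, c127b)]),
    (m13, [px, px, px, px, px, px, px, px, py], [(1, [])],
      [(3, c3), (5, c5), (7, c7a), (13, c13), (17, c17a), (31, c31c), (73, c73b), (127, c127b)]),
    (s9, [px, py, m1, m1, m1, m1, m1], [(1, [])],
      [(3, c3), (5, c5), (7, c7a), (13, c13), (17, c17a), (31, c31b), (73, c73b), (127, c127b)]),
    (s10, [px, px, px, px, py, m1], [(1, [])],
      [(3, c3), (5, c5), (7, c7a), (13, c13), (17, c17a), (31, c31b), (73, c73b), (127, c127c)]),
    (s11, [px, py, py, m1], [(1, [])],
      [(3, c3), (5, c5), (7, c7b), (13, c13), (17, c17a), (31, c31b), (73, c73b), (127, c127b)]),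
    (s12, [px, px, py, m1, m1], [(1, [])],
      [(3, c3), (5, c5), (7, c7a), (13, c13), (17, c17a), (31, c31c), (73, c73b), (127, c127d)]),
    (s13, [px, py, py, py, py, m1], [(1, [])],
      [(3, c3), (5, c5), (7, c7a), (13, c13), (17, c17a), (31, c31b), (73, c73b), (127, c127c)]),
    (s14, [px, px, py, m1], [(1, [])],
      [(3, c3), (5, c5), (7, c7b), (13, c13), (17, c17a), (31, c31b), (73, c73b), (127, c127b)]),
    (s15, [px, py, py, m1, m1], [(1, [])],
      [(3, c3), (5, c5), (7, c7a), (13, c13), (17, c17a), (31, c31c), (73, c73b), (127, c127d)])]"

definition irreducible_list :: "bool list \<Rightarrow> bool" where
  "irreducible_list Q \<longleftrightarrow>
    list_all (\<lambda>k. list_all (\<lambda>q. \<not> divides (True # q) Q) (List.n_lists k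
      [True, False]))
      [1..<Suc ((length Q - 1) div 2)]"

text \<open>Says that \<open>Q\<close> divides \<open>X ^ (2 ^ d) + X\<close> where \<open>d\<close> is the degree of \<open>Q\<close>.\<close>
definition fermat_list :: "bool list \<Rightarrow> bool" where
  "fermat_list Q \<longleftrightarrow>
    divides Q (True # replicate (2 ^ (length Q - 1) - 2) False @ [True, False])"

definition refuted :: "bool list \<Rightarrow> nat \<times> bool list \<Rightarrow> bool" where
  "refuted P = (\<lambda>(u, g). monic_list g \<and> divides g (replicate u True) \<and>
    (\<lambda>R. nonconst R \<and> list_all (\<lambda>Q. \<not> divides Q R) factor_base)
      (fold strip factor_base (comp [] g P)))"

definition over_base :: "bool list list \<Rightarrow> bool" where
  "over_base Qs \<longleftrightarrow> list_all (\<lambda>Q. Q \<in> set factor_base) Qs"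

text \<open>The prime divisors of the numbers \<open>2 ^ d - 1\<close>, where \<open>d\<close> is the degree of a member of \<open>factor_base\<close>.\<close>
definition torsion_primes :: "nat list" where
  "torsion_primes = [3, 5, 7, 13, 17, 31, 73, 127]"

text \<open>A finite certificate for an induction over odd \<open>u\<close>: starting at 1,
  multiplication by an admissible prime either stays in the list or produces a multiple of a refuted
  number.\<close>

definition product_closed :: "nat list \<Rightarrow> nat list \<Rightarrow> bool" where
  "product_closed us bad \<longleftrightarrow> 1 \<in> set us \<and>
    (\<forall>p\<in>set torsion_primes. \<forall>u\<in>set us. p * u \<in> set us \<or>
      (\<exists>b\<in>set bad. b dvd p * u))"

section \<open>Evaluation of the certificates\<close>

lemma factor_base_monic: "list_all monic_list factor_base" by code_simp
lemma factor_base_distinct: "distinct factor_base" by code_simp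
lemma factor_base_table: "map fst table = factor_base" by code_simp
lemma factor_base_irreducible: "list_all irreducible_list factor_base" by code_simp
lemma factor_base_fermat: "list_all fermat_list factor_base" by code_simp
lemma table_closed: "list_all (\<lambda>(P, fs, us, bad). product_closed (map fst us) (map fst bad))
  table" by code_simp
lemma table_refuted: "list_all (\<lambda>(P, fs, us, bad). list_all (refuted P) bad) table" by
  code_simp
lemma table_over_base:
  "list_all (\<lambda>(P, fs, us, bad). over_base fs \<and> list_all (\<lambda>(u, ds). over_base
    ds) us) table"
  by code_simp
text \<open>The computed lists may differ in leading zeros, so they are compared after
  \<open>trim\<close>.\<close>

lemma table_factors:
  "list_all (\<lambda>(P, fs, us, bad). trim (flip_last P) = trim (mul_list fs) \<and>
    list_all (\<lambda>(u, ds). trim (geo_list u P) = trim (mul_list ds)) us) table"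
  by code_simp

section \<open>Consequences of the certificates\<close>

lemma pol_monic_list_inj:
  assumes "monic_list P" "monic_list Q" "pol P = pol Q" shows "P = Q"
proof -
  have "length P = length Q"
    using assms by (metis degree_monic_list One_nat_def Suc_pred length_greater_0_conv
      monic_list.simps(2))
  moreover have "rev P ! i = rev Q ! i" if "i < length P" for i
    using assms(3) that \<open>length P = length Q\<close> coeff_pol[of P i] coeff_pol[of Q i]
    by (metis of_bool_eq_iff)
  ultimately have "rev P = rev Q" by (intro nth_equalityI) auto
  then show ?thesis by simp
qed

lemma factor_base_monicD: "Q \<in> set factor_base \<Longrightarrow> monic_list Q"
  using factor_base_monic by (auto simp: list_all_iff)

text \<open>Distinct lists stand for distinct primes, so multiplicities can be read off as list
  counts.\<close>

lemma inj_on_pol_factor_base: "inj_on pol (set factor_base)"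
  by (intro inj_onI pol_monic_list_inj factor_base_monicD)

lemma bit_poly_eq_pol:
  assumes "p \<noteq> 0" obtains q where "length q = degree p" "p = pol (True # q)"
proof
  let ?q = "map (\<lambda>i. coeff p i = 1) (rev [0..<degree p])"
  show "length ?q = degree p" by simp
  show "p = pol (True # ?q)"
  proof (rule poly_eqI)
    fix i
    have "coeff p (degree p) = 1" using assms lead_coeff_bit_poly by blast
    then show "coeff p i = coeff (pol (True # ?q)) i"
      by (cases "i < degree p"; cases "i = degree p")
        (auto simp: coeff_pol nth_append rev_map coeff_eq_0)
  qed
qed

text \<open>Trial division suffices up to half the degree, because one factor of any proper
  factorization lies in that range.\<close>

lemma irreducible_listD:
  assumes Q: "monic_list Q" and irr: "irreducible_list Q" shows "prime (pol Q)"
proof -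
  have small: "\<not> p dvd pol Q" if "0 < degree p" "degree p \<le> (length Q - 1) div 2" for p
  proof -
    have "p \<noteq> 0" using that by auto
    then obtain q where q: "length q = degree p" "p = pol (True # q)" by (rule bit_poly_eq_pol)
    then have "monic_list (True # q)" using that by (cases q) auto
    have "q \<in> set (List.n_lists (degree p) [True, False])"
      using q by (auto simp: set_n_lists)
    moreover have "degree p \<in> set [1..<Suc ((length Q - 1) div 2)]" using that by auto
    ultimately have "\<not> divides (True # q) Q"
      using irr unfolding irreducible_list_def list_all_iff by blast
    then show ?thesis using \<open>monic_list (True # q)\<close> q divides_iff by blast
  qed
  have deg: "degree (pol Q) = length Q - 1" "degree (pol Q) > 0"
    using Q by (auto simp: degree_monic_list elim!: monic_listE)
  have "irreducible (pol Q)"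
  proof (rule irreducibleI)
    show "pol Q \<noteq> 0" "\<not> is_unit (pol Q)" using deg by (auto simp: bit_poly_unit)
    fix a b assume ab: "pol Q = a * b"
    then have nz: "a \<noteq> 0" "b \<noteq> 0" using deg by auto
    then have "degree a + degree b = length Q - 1" using ab deg by (simp add: degree_mult_eq)
    then have "degree a \<le> (length Q - 1) div 2 \<or> degree b \<le> (length Q - 1) div 2" by
      linarith
    then have "degree a = 0 \<or> degree b = 0"
      using small[of a] small[of b] ab by (metis dvd_triv_left dvd_triv_right gr0I)
    then show "is_unit a \<or> is_unit b" using nz by (simp add: is_unit_iff_degree)
  qed
  then show ?thesis by (simp add: prime_bit_poly_iff)
qed

lemma factor_base_prime: "Q \<in> set factor_base \<Longrightarrow> prime (pol Q)"
  using factor_base_irreducible factor_base_monicD irreducible_listD by (auto simp: list_all_iff)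

lemma fermat_listD:
  assumes "monic_list Q" "fermat_list Q"
  shows "pol Q dvd X ^ 2 ^ (length Q - 1) + X"
proof -
  have l: "length Q - 1 > 0" using assms(1) by (auto elim: monic_listE)
  \<comment> \<open>The degree is positive, so the natural subtraction \<open>2 ^ d - 2\<close> in
    the list is a true one.\<close>
  then have "(2::nat) ^ 1 \<le> 2 ^ (length Q - 1)" by (intro power_increasing) auto
  then have e: "2 ^ (length Q - 1) - 2 + 2 = (2 :: nat) ^ (length Q - 1)" by simp
  have "pol (True # replicate n False @ [True, False]) = X ^ (n + 2) + X" for n
    by (simp add: pol_append monom_altdef)
  from this[of "2 ^ (length Q - 1) - 2"]
  have "pol (True # replicate (2 ^ (length Q - 1) - 2) False @ [True, False]) =
      X ^ 2 ^ (length Q - 1) + X" by (simp only: e)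
  then show ?thesis using assms by (simp add: fermat_list_def divides_iff)
qed

lemma prime_dvd_two_power_minus_one:
  assumes p: "prime p" and dvd: "p dvd 2 ^ d - 1" and d: "d \<in> {1, 2, 3, 4, 5, 6, 7, 8, 9, 12}"
  shows "p \<in> set torsion_primes"
proof -
  \<comment> \<open>A common multiple of the numbers \<open>2 ^ d - 1\<close>; the second 3 comes
    from \<open>d = 6\<close> and \<open>d = 12\<close>.\<close>
  have "(2::nat) ^ d - 1 dvd 3 * 3 * 5 * 7 * 13 * 17 * 31 * 73 * 127" using d by auto
  then have "p dvd 3 * 3 * 5 * 7 * 13 * 17 * 31 * 73 * 127" using dvd dvd_trans by blast
  then have "p dvd 3 \<or> p dvd 5 \<or> p dvd 7 \<or> p dvd 13 \<or> p dvd 17 \<or> p dvd 31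
    \<or> p dvd 73 \<or> p dvd 127"
    using p by (simp only: prime_dvd_mult_iff) blast
  moreover have "prime (3::nat)" "prime (5::nat)" "prime (7::nat)" "prime (13::nat)"
    "prime (17::nat)" "prime (31::nat)" "prime (73::nat)" "prime (127::nat)" by simp_all
  ultimately have "p = 3 \<or> p = 5 \<or> p = 7 \<or> p = 13 \<or> p = 17 \<or> p = 31 \<or> p =
    73 \<or> p = 127"
    using p primes_dvd_imp_eq by blast
  then show ?thesis by (auto simp: torsion_primes_def)
qed

definition smooth :: "bit poly \<Rightarrow> bool" where
  "smooth f \<longleftrightarrow> (\<forall>R. prime R \<longrightarrow> R dvd f \<longrightarrow>
    R \<in> pol ` set factor_base)"

lemma smooth_dvd: "smooth g \<Longrightarrow> f dvd g \<Longrightarrow> smooth f"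
  unfolding smooth_def using dvd_trans by blast

lemma bit_poly_prime_divisor:
  assumes "p \<noteq> 0" "p \<noteq> 1" obtains R :: "bit poly" where "prime R" "R dvd p"
  using assms prime_divisor_exists[of p] bit_poly_unit by blast

text \<open>\<open>g(P)\<close> divides \<open>geo u P\<close>, and so does the part left after
  stripping. That part is nonconstant and has no divisor in the base, so it has a foreign prime
  factor.\<close>

lemma refutedD:
  assumes "refuted P (u, g)" shows "\<not> smooth (geo u (pol P))"
proof
  let ?R = "fold strip factor_base (comp [] g P)"
  assume "smooth (geo u (pol P))"
  have g: "monic_list g" "divides g (replicate u True)" and R: "nonconst ?R"
    "\<And>Q. Q \<in> set factor_base \<Longrightarrow> \<not> divides Q ?R"
    using assms by (auto simp: refuted_def list_all_iff)
  have "pol g dvd geo u X" using g by (simp add: divides_iff pol_replicate_True)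
  then have "pcompose (pol g) (pol P) dvd geo u (pol P)"
    using dvd_pcompose pcompose_geo_X by metis
  moreover have "pol ?R dvd pol (comp [] g P)" by (rule fold_strip_dvd[OF factor_base_monic])
  ultimately have dvd: "pol ?R dvd geo u (pol P)" by (auto simp: pol_comp intro: dvd_trans)
  obtain S where S: "prime S" "S dvd pol ?R" using nonconstD[OF R(1)] bit_poly_prime_divisor by
    blast
  then have "S \<in> pol ` set factor_base"
    using \<open>smooth (geo u (pol P))\<close> dvd unfolding smooth_def by (meson dvd_trans)
  then show False using R(2) S by (auto simp: divides_iff factor_base_monicD)
qed

lemma table_entry:
  assumes "(P, fs, us, bad) \<in> set table"
  shows "P \<in> set factor_base" "product_closed (map fst us) (map fst bad)" "\<And>b. b \<in> set bad
    \<Longrightarrow> refuted P b"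
    "over_base fs" "1 + pol P = (\<Prod>f\<leftarrow>fs. pol f)"
    "\<And>u ds. (u, ds) \<in> set us \<Longrightarrow> over_base ds"
    "\<And>u ds. (u, ds) \<in> set us \<Longrightarrow> geo u (pol P) = (\<Prod>f\<leftarrow>ds.
      pol f)"
proof -
  show "P \<in> set factor_base" using assms by (force simp flip: factor_base_table)
  show "product_closed (map fst us) (map fst bad)" "\<And>b. b \<in> set bad \<Longrightarrow> refuted P
    b" "over_base fs"
    "\<And>u ds. (u, ds) \<in> set us \<Longrightarrow> over_base ds"
    using table_closed table_refuted table_over_base assms unfolding list_all_iff by fastforce+
  have "pol (trim (flip_last P)) = pol (trim (mul_list fs))"
    "\<And>u ds. (u, ds) \<in> set us \<Longrightarrow> pol (trim (geo_list u P)) = pol (trim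
      (mul_list ds))"
    using table_factors assms unfolding list_all_iff by fastforce+
  then show "1 + pol P = (\<Prod>f\<leftarrow>fs. pol f)"
    "\<And>u ds. (u, ds) \<in> set us \<Longrightarrow> geo u (pol P) = (\<Prod>f\<leftarrow>ds.
      pol f)" by simp_all
qed

lemma factor_base_lengths: "length ` set factor_base \<subseteq> Suc ` {1, 2, 3, 4, 5, 6, 7, 8, 9,
  12}"
  by code_simp

text \<open>Write \<open>u = p * v\<close> with \<open>p\<close> prime. Both \<open>geo p P\<close>
  and \<open>geo v P\<close> divide \<open>geo u P\<close> and are smooth: the first makes
  \<open>p\<close> a torsion prime, the second puts \<open>v\<close> into the list by induction.
  Closure under products then lists \<open>u\<close> or gives it a refuted divisor.\<close>

lemma smooth_geo_imp:
  assumes entry: "(P, fs, us, bad) \<in> set table" and "odd u" "smooth (geo u (pol P))"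
  shows "u \<in> fst ` set us"
  using assms(2,3)
proof (induction u rule: less_induct)
  case (less u)
  note entry = table_entry[OF entry]
  have P1: "pol P \<noteq> 1" using factor_base_prime[OF entry(1)] by auto
  have closed: "1 \<in> fst ` set us"
    "\<And>p v. p \<in> set torsion_primes \<Longrightarrow> v \<in> fst ` set us \<Longrightarrow>
      p * v \<in> fst ` set us \<or> (\<exists>b\<in>fst ` set bad. b dvd p * v)"
    using entry(2) unfolding product_closed_def by auto
  show ?case
  proof (cases "u = 1")
    case False
    then obtain p where p: "prime p" "p dvd u" using prime_factor_nat by blast
    then obtain v where v: "u = p * v" by blast
    have odd: "odd p" "odd v" using less.prems(1) v by auto
    have "u > 0" using less.prems(1) by (auto elim: oddE)
    then have pv: "p > 1" "v > 0" using prime_gt_1_nat[OF p(1)] v by auto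
    have "geo p (pol P) dvd geo u (pol P)" "geo v (pol P) dvd geo u (pol P)"
      using v pv P1 by (auto intro!: geo_dvd_geo)
    then have sm: "smooth (geo p (pol P))" "smooth (geo v (pol P))"
      using less.prems(2) smooth_dvd by blast+
    have "v < u" using v pv by simp
    then have "v \<in> fst ` set us" using less.IH odd sm by blast
    moreover have "p \<in> set torsion_primes"
    proof -
      \<comment> \<open>Powers of \<open>P\<close> are never 1, so \<open>geo p P\<close> is neither
        0 nor 1 and has a prime divisor to which the field argument applies.\<close>
      have "pol P ^ k \<noteq> 1" if "k > 0" for k
        using that P1 by (metis bit_poly_unit dvd_power)
      moreover have "pol P ^ p = pol P * pol P ^ (p - 1)" using pv by (cases p) auto
      moreover have "pol P \<noteq> 0" using factor_base_prime[OF entry(1)] by auto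
      ultimately have "1 + pol P ^ p \<noteq> 0" "1 + pol P ^ p \<noteq> 1 + pol P"
        using pv by (auto simp: add_eq_0_bit_poly)
      then have "geo p (pol P) \<noteq> 0" "geo p (pol P) \<noteq> 1"
        using geo_times[of "pol P" p] by auto
      then obtain R where R: "prime R" "R dvd geo p (pol P)" using bit_poly_prime_divisor by blast
      then obtain Q where Q: "Q \<in> set factor_base" "R = pol Q" using sm unfolding smooth_def
        by blast
      have "fermat_list Q" using factor_base_fermat Q by (auto simp: list_all_iff)
      then have "pol Q dvd X ^ 2 ^ (length Q - 1) + X"
        by (intro fermat_listD factor_base_monicD Q)
      then have "p dvd 2 ^ (length Q - 1) - 1" using R Q p odd dvd_geo_prime_imp by blast
      moreover have "length Q - 1 \<in> {1, 2, 3, 4, 5, 6, 7, 8, 9, 12}"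
        using factor_base_lengths Q(1) by fastforce
      ultimately show ?thesis using p prime_dvd_two_power_minus_one by blast
    qed
    ultimately have "u \<in> fst ` set us \<or> (\<exists>b\<in>fst ` set bad. b dvd u)"
      using closed v by blast
    moreover have "\<not> b dvd u" if "(b, g) \<in> set bad" for b g
    proof
      assume "b dvd u"
      then have "geo b (pol P) dvd geo u (pol P)"
        using \<open>u > 0\<close> P1 by (intro geo_dvd_geo) (auto intro!: Nat.gr0I)
      then have "smooth (geo b (pol P))" using less.prems(2) smooth_dvd by blast
      then show False using refutedD entry(3)[OF that] by blast
    qed
    ultimately show ?thesis by force
  qed (use closed in simp)
qed

section \<open>The exponent equations\<close>

definition entry :: "bool list \<Rightarrow> bool list list \<times> (nat \<times> bool list list)
  list \<times> (nat \<times> bool list) list" where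
  "entry P = the (map_of table P)"

definition shifted :: "bool list \<Rightarrow> bool list list" where
  "shifted P = fst (entry P)"

definition orders :: "bool list \<Rightarrow> nat list" where
  "orders P = map fst (fst (snd (entry P)))"

definition cyc :: "bool list \<Rightarrow> nat \<Rightarrow> bool list list" where
  "cyc P u = the (map_of (fst (snd (entry P))) u)"

lemma entry_in_table:
  assumes "P \<in> set factor_base"
  obtains bad where "(P, shifted P, fst (snd (entry P)), bad) \<in> set table"
proof -
  have "P \<in> fst ` set table" using assms by (simp flip: factor_base_table)
  then obtain x where "map_of table P = Some x" by (metis map_of_eq_None_iff option.exhaust)
  then have "(P, entry P) \<in> set table" by (simp add: entry_def map_of_SomeD)
  then show thesis using that by (metis shifted_def prod.collapse)
qed

lemma one_plus_pol:
  assumes "P \<in> set factor_base"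
  shows "over_base (shifted P)" "1 + pol P = (\<Prod>f\<leftarrow>shifted P. pol f)"
  using entry_in_table[OF assms] table_entry by metis+

lemma geo_pol:
  assumes "P \<in> set factor_base" "u \<in> set (orders P)"
  shows "over_base (cyc P u)" "geo u (pol P) = (\<Prod>f\<leftarrow>cyc P u. pol f)"
proof -
  have "(u, cyc P u) \<in> set (fst (snd (entry P)))"
    using assms(2) unfolding orders_def cyc_def
    by (metis list.set_map map_of_SomeD map_of_eq_None_iff option.collapse)
  then show "over_base (cyc P u)" "geo u (pol P) = (\<Prod>f\<leftarrow>cyc P u. pol f)"
    using entry_in_table[OF assms(1)] table_entry(6,7) by metis+
qed

lemma smooth_geo_orders:
  assumes "P \<in> set factor_base" "odd u" "smooth (geo u (pol P))"
  shows "u \<in> set (orders P)"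
  using entry_in_table[OF assms(1)] smooth_geo_imp assms(2,3) unfolding orders_def by (metis
    list.set_map)

lemma multiplicity_prod_list_pol:
  assumes "Q \<in> set factor_base" "over_base Ps"
  shows "multiplicity (pol Q) (\<Prod>P\<leftarrow>Ps. pol P) = count_list Ps Q"
    "(\<Prod>P\<leftarrow>Ps. pol P) \<noteq> 0"
proof -
  have "multiplicity (pol Q) (\<Prod>P\<leftarrow>Ps. pol P) = count_list Ps Q \<and>
    (\<Prod>P\<leftarrow>Ps. pol P) \<noteq> 0"
    using assms(2)
  proof (induction Ps)
    case (Cons P Ps)
    then have P: "P \<in> set factor_base" and IH: "multiplicity (pol Q) (\<Prod>P\<leftarrow>Ps.
      pol P) = count_list Ps Q"
      "(\<Prod>P\<leftarrow>Ps. pol P) \<noteq> 0" by (simp_all add: over_base_def)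
    have "multiplicity (pol Q) (pol P) = (if P = Q then 1 else 0)"
      using factor_base_prime[OF P] factor_base_prime[OF assms(1)]
        inj_onD[OF inj_on_pol_factor_base _ P assms(1)] by (auto intro: prime_multiplicity_other)
    moreover have "pol P \<noteq> 0" using factor_base_prime[OF P] by auto
    ultimately show ?case using IH factor_base_prime[OF assms(1)]
      by (simp add: prime_elem_multiplicity_mult_distrib)
  qed simp
  then show "multiplicity (pol Q) (\<Prod>P\<leftarrow>Ps. pol P) = count_list Ps Q"
    "(\<Prod>P\<leftarrow>Ps. pol P) \<noteq> 0" by auto
qed

lemma smooth_eq_prod:
  assumes "A \<noteq> 0" "smooth A"
  shows "A = (\<Prod>P\<in>set factor_base. pol P ^ multiplicity (pol P) A)"
proof -
  have "A = (\<Prod>R\<in>prime_factors A. R ^ multiplicity R A)"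
    using prod_prime_factors[OF assms(1)] by simp
  also have "\<dots> = (\<Prod>R\<in>pol ` set factor_base. R ^ multiplicity R A)"
    using assms by (intro prod.mono_neutral_left)
      (auto simp: smooth_def in_prime_factors_iff factor_base_prime not_dvd_imp_multiplicity_0)
  also have "\<dots> = (\<Prod>P\<in>set factor_base. pol P ^ multiplicity (pol P) A)"
    by (simp add: prod.reindex[OF inj_on_pol_factor_base])
  finally show ?thesis .
qed

lemma sigma_eq_prod_geo:
  assumes "A \<noteq> 0" "smooth A"
  shows "sigma A = (\<Prod>P\<in>set factor_base. geo (Suc (multiplicity (pol P) A)) (pol P))"
proof -
  let ?e = "\<lambda>R. multiplicity R A"
  have "sigma A = sigma (\<Prod>R\<in>pol ` set factor_base. R ^ ?e R)"
    by (subst smooth_eq_prod[OF assms]) (simp add: prod.reindex[OF inj_on_pol_factor_base])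
  also have "\<dots> = (\<Prod>R\<in>pol ` set factor_base. geo (Suc (?e R)) R)"
    by (rule sigma_prod_prime_powers) (auto simp: factor_base_prime)
  finally show ?thesis by (simp only: prod.reindex[OF inj_on_pol_factor_base] o_def)
qed

lemma nat_eq_two_power_times_odd:
  assumes "n > 0" obtains k u :: nat where "n = 2 ^ k * u" "odd u"
  using multiplicity_decompose'[of n 2] assms that by (metis neq0_conv nat_dvd_1_iff_1
    numeral_eq_one_iff semiring_norm(85))

text \<open>The multiplicity of \<open>Q\<close> in sigma of \<open>P ^ (N P * u P - 1)\<close>,
  read off from \<open>geo_pow2_mult\<close>.\<close>

definition incidence :: "(bool list \<Rightarrow> nat) \<Rightarrow> (bool list \<Rightarrow> nat)
  \<Rightarrow> bool list \<Rightarrow> bool list \<Rightarrow> nat" where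
  "incidence N u Q P =
    (N P - 1) * count_list (shifted P) Q + N P * count_list (cyc P (u P)) Q"

text \<open>Both sides of \<open>sigma A = A\<close> are products over the base; the last conclusion
  compares the multiplicities of \<open>Q\<close>, with 1 added on both sides.\<close>

lemma perfect_exponent_equations:
  assumes "A \<noteq> 0" "sigma A = A" "smooth A"
  obtains N u :: "bool list \<Rightarrow> nat" where
    "\<And>P. P \<in> set factor_base \<Longrightarrow> (\<exists>n. N P = 2 ^ n) \<and> u P \<in>
      set (orders P)"
    "\<And>P. P \<in> set factor_base \<Longrightarrow> Suc (multiplicity (pol P) A) = N P * u P"
    "\<And>Q. Q \<in> set factor_base \<Longrightarrow> N Q * u Q = Suc (\<Sum>P\<in>set
      factor_base. incidence N u Q P)"
proof -
  let ?e = "\<lambda>P. multiplicity (pol P) A"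
  have A: "A = (\<Prod>P\<in>set factor_base. geo (Suc (?e P)) (pol P))"
    using sigma_eq_prod_geo[OF assms(1,3)] assms(2) by simp
  have ex: "\<exists>n u. Suc (?e P) = 2 ^ n * u \<and> u \<in> set (orders P)" if P: "P \<in> set
    factor_base" for P
  proof -
    obtain n u where nu: "Suc (?e P) = 2 ^ n * u" "odd u"
      using nat_eq_two_power_times_odd[of "Suc (?e P)"] by auto
    have "u > 0" using nu by (auto elim: oddE)
    moreover have "pol P \<noteq> 1" using factor_base_prime[OF P] by auto
    \<comment> \<open>This factor of \<open>sigma A\<close> divides \<open>A\<close>, hence is
      smooth, which leaves only the listed \<open>u\<close>.\<close>
    ultimately have "geo u (pol P) dvd geo (Suc (?e P)) (pol P)"
      using nu by (intro geo_dvd_geo) auto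
    also have "\<dots> dvd A" using P by (subst (2) A) (intro dvd_prodI, auto)
    finally have "smooth (geo u (pol P))" using assms(3) smooth_dvd by blast
    then show ?thesis using smooth_geo_orders P nu by blast
  qed
  then obtain n u where nu: "\<And>P. P \<in> set factor_base \<Longrightarrow>
      Suc (?e P) = 2 ^ n P * u P \<and> u P \<in> set (orders P)" by metis
  define N :: "bool list \<Rightarrow> nat" where "N = (\<lambda>P. 2 ^ n P)"
  have geo: "geo (Suc (?e P)) (pol P) \<noteq> 0 \<and>
      multiplicity (pol Q) (geo (Suc (?e P)) (pol P)) = incidence N u Q P"
    if P: "P \<in> set factor_base" and Q: "Q \<in> set factor_base" for P Q
  proof -
    have P1: "pol P \<noteq> 1" using factor_base_prime[OF P] by auto
    have "geo (Suc (?e P)) (pol P) = (1 + pol P) ^ (N P - 1) * geo (u P) (pol P) ^ N P"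
      using geo_pow2_mult[OF P1, of "n P" "u P"] nu[OF P] by (simp only: N_def)
    also have "\<dots> = (\<Prod>f\<leftarrow>shifted P. pol f) ^ (N P - 1) *
      (\<Prod>f\<leftarrow>cyc P (u P). pol f) ^ N P"
      using one_plus_pol[OF P] geo_pol[OF P] nu[OF P] by simp
    finally show ?thesis
      using multiplicity_prod_list_pol[OF Q] one_plus_pol(1)[OF P] geo_pol(1)[OF P] nu[OF P]
        factor_base_prime[OF Q]
      by (simp add: prime_elem_multiplicity_mult_distrib prime_elem_multiplicity_power_distrib
          incidence_def)
  qed
  show thesis
  proof
    show "(\<exists>n. N P = 2 ^ n) \<and> u P \<in> set (orders P)" "Suc (?e P) = N P * u P"
      if "P \<in> set factor_base" for P using nu[OF that] by (auto simp: N_def)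
    then show "N Q * u Q = Suc (\<Sum>P\<in>set factor_base. incidence N u Q P)"
      if Q: "Q \<in> set factor_base" for Q
    proof -
      have "?e Q = (\<Sum>P\<in>set factor_base. multiplicity (pol Q) (geo (Suc (?e P)) (pol P)))"
        using factor_base_prime[OF Q] geo
        by (subst A, subst prime_elem_multiplicity_prod_distrib) auto
      also have "\<dots> = (\<Sum>P\<in>set factor_base. incidence N u Q P)"
        using geo Q by (intro sum.cong) auto
      finally show ?thesis using nu[OF Q] by (simp add: N_def)
    qed
  qed
qed

section \<open>Search through classes of exponents\<close>

definition core :: "bool list list" where
  "core = [px, s3, s4, py, s5, s6, s8, m1, s2, s1, m2, s7, m3, m4, m5]"

text \<open>A power of two is \<open>1\<close>, \<open>2\<close> or a positive multiple of \<open>4\<close>; knowing only this, the exponent equations are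
  tested modulo \<open>4\<close> and for size. \<open>(m, True)\<close> stands for the set \<open>{m, m + 4, m + 8, \<dots>}\<close> and \<open>(m, False)\<close> for \<open>{m}\<close>.\<close>

fun in_class :: "nat \<Rightarrow> nat \<times> bool \<Rightarrow> bool" where
  "in_class n (m, True) \<longleftrightarrow> (\<exists>j. n = m + 4 * j)"
| "in_class n (m, False) \<longleftrightarrow> n = m"

fun meet :: "nat \<times> bool \<Rightarrow> nat \<times> bool \<Rightarrow> bool" where
  "meet (l, False) (r, False) = (l = r)"
| "meet (l, True) (r, False) = (l \<le> r \<and> 4 dvd r - l)"
| "meet (l, False) (r, True) = (r \<le> l \<and> 4 dvd l - r)"
| "meet (l, True) (r, True) = (l mod 4 = r mod 4)"

text \<open>The class assumed for \<open>N P\<close>, followed by the value of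
  \<open>u P\<close>.\<close>

type_synonym choice = "(nat \<times> bool) \<times> nat"

text \<open>The share of one prime in the equation of another: \<open>Some (k, ws)\<close> stands
  for \<open>(N - 1) * k + N * weight ws u\<close>, and \<open>None\<close> for a share that is 0
  for every \<open>u\<close>.\<close>

type_synonym cell = "(nat \<times> (nat \<times> nat) list) option"

fun weight :: "(nat \<times> nat) list \<Rightarrow> nat \<Rightarrow> nat" where
  "weight [] u = 0"
| "weight ((v, c) # ws) u = (if u = v then c else weight ws u)"

fun sum_cells :: "cell list \<Rightarrow> choice list \<Rightarrow> nat \<Rightarrow> bool
  \<Rightarrow> nat \<times> bool" where
  "sum_cells (None # cs) (a # as) m b = sum_cells cs as m b"
| "sum_cells (Some (k, ws) # cs) (((x, False), u) # as) m b =
    sum_cells cs as (m + k * (x - 1) + weight ws u * x) b"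
| "sum_cells (Some (k, ws) # cs) (((x, True), u) # as) m b =
    sum_cells cs as (m + k * (x - 1) + weight ws u * x) (b \<or> k > 0 \<or> weight ws u > 0)"
| "sum_cells cs as m b = (m, b)"

text \<open>The flags mark the row of the prime whose equation is tested. The last clause is a
  default for lists without a set flag, which \<open>own_value_sound\<close> excludes.\<close>

fun own_value :: "bool list \<Rightarrow> choice list \<Rightarrow> nat \<times> bool" where
  "own_value (True # os) (((x, b), u) # as) = (x * u, b)"
| "own_value (False # os) (a # as) = own_value os as"
| "own_value os as = (0, True)"

type_synonym level = "choice list \<times> (bool list \<times> cell list) list"

text \<open>Depth-first: each level puts the choice for one more prime at the head and tests the
  equations that it completes.\<close>

fun search :: "level list \<Rightarrow> choice list \<Rightarrow> choice list list" where
  "search [] as = [as]"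
| "search ((cs, eqs) # ls) as = concat (map (\<lambda>c.
    if list_all (\<lambda>(os, cells). meet (own_value os (c # as)) (sum_cells cells (c # as) 1
      False)) eqs
    then search ls (c # as) else []) cs)"

type_synonym row = "bool list \<times> bool list list \<times> (nat \<times> bool list list) list"

fun cell :: "bool list \<Rightarrow> row \<Rightarrow> cell" where
  "cell Q (P, fs, us) = (if count_list fs Q = 0 \<and> list_all (\<lambda>(u, ds). count_list ds Q
    = 0) us
    then None else Some (count_list fs Q, map (\<lambda>(u, ds). (u, count_list ds Q)) us))"

fun choices :: "row \<Rightarrow> choice list" where
  "choices (P, fs, us) =
    concat (map (\<lambda>(u, ds). [((1, False), u), ((2, False), u), ((4, True), u)]) us)"

fun levels :: "row list \<Rightarrow> (row \<times> bool list list) list \<Rightarrow> level list"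
  where
  "levels Ps [] = []"
| "levels Ps ((P, Qs) # pl) = (choices P,
    map (\<lambda>Q. (map (\<lambda>R. fst R = Q) (P # Ps), map (cell Q) (P # Ps))) Qs) # levels
      (P # Ps) pl"

text \<open>An equation may be tested once the row of its own prime is present and every later row
  contributes nothing, whatever its \<open>u\<close>.\<close>

fun sound_plan :: "row list \<Rightarrow> (row \<times> bool list list) list \<Rightarrow> bool"
  where
  "sound_plan Ps [] = True"
| "sound_plan Ps ((P, Qs) # pl) = (list_all (\<lambda>Q. Q \<in> fst ` set (P # Ps) \<and>
      list_all (\<lambda>(R, _). cell Q R = None) pl) Qs \<and> sound_plan (P # Ps) pl)"

text \<open>\<open>targets ! i\<close> are the primes whose equation involves no unknown beyond the first \<open>i + 1\<close>.\<close>
definition targets :: "bool list list list" where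
  "targets = [[], [s3], [s4], [], [s5], [s6], [], [s8], [s2], [s1], [m2], [s7], [m3, m1], [m4],
    [m5, px, py]]"

definition plan :: "(row \<times> bool list list) list" where
  "plan = zip (map (\<lambda>(P, fs, us, bad). (P, fs, us)) table) targets"

text \<open>Unlisted primes have \<open>N = u = 1\<close>, hence exponent 0. The empty list is the
  polynomial 1, and the two lists with only \<open>px\<close> and \<open>py\<close> give powers of
  x(x + 1).\<close>

definition solutions :: "(bool list \<times> choice) list list" where
  "solutions = [[],
    [(px, ((2, False), 1)), (py, ((2, False), 1))],
    [(px, ((2, False), 1)), (py, ((1, False), 3)), (m1, ((2, False), 1))],
    [(px, ((2, False), 1)), (py, ((1, False), 3)), (m1, ((1, False), 3)), (s1, ((2, False), 1))],
    [(px, ((4, True), 1)), (py, ((4, True), 1))],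
    [(px, ((4, True), 1)), (py, ((1, False), 5)), (m5, ((2, False), 1))],
    [(px, ((4, True), 1)), (py, ((1, False), 7)), (m2, ((2, False), 1)), (m3, ((2, False), 1))],
    [(px, ((1, False), 3)), (py, ((2, False), 1)), (m1, ((2, False), 1))],
    [(px, ((1, False), 3)), (py, ((2, False), 1)), (m1, ((1, False), 3)), (s1, ((2, False), 1))],
    [(px, ((1, False), 5)), (py, ((4, True), 1)), (m4, ((2, False), 1))],
    [(px, ((1, False), 5)), (py, ((1, False), 5)), (m4, ((2, False), 1)), (m5, ((2, False), 1))],
    [(px, ((1, False), 5)), (py, ((1, False), 7)), (m2, ((2, False), 1)), (m3, ((2, False), 1)),
      (m4, ((2, False), 1))],
    [(px, ((1, False), 7)), (py, ((4, True), 1)), (m2, ((2, False), 1)), (m3, ((2, False), 1))],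
    [(px, ((1, False), 7)), (py, ((1, False), 5)), (m2, ((2, False), 1)), (m3, ((2, False), 1)),
      (m5, ((2, False), 1))]]"

definition choice_of :: "(bool list \<times> choice) list \<Rightarrow> bool list \<Rightarrow>
  choice" where
  "choice_of s P = (case map_of s P of None \<Rightarrow> ((1, False), 1) | Some c \<Rightarrow> c)"

lemma plan_core: "map (fst \<circ> fst) plan = core" by code_simp

lemma plan_sound: "sound_plan [] plan" by code_simp

text \<open>The order of \<open>core\<close> is reversed because the search conses the newest
  choice.\<close>

lemma search_plan: "search (levels [] plan) [] = map (\<lambda>s. map (choice_of s) (rev core))
  solutions"
  by code_simp

definition row_incidence :: "(bool list \<Rightarrow> nat) \<Rightarrow> (bool list \<Rightarrow>
  nat) \<Rightarrow> bool list \<Rightarrow> row \<Rightarrow> nat" where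
  "row_incidence N u Q = (\<lambda>(P, fs, us).
    (N P - 1) * count_list fs Q + N P * count_list (the (map_of us (u P))) Q)"

definition admissible :: "(bool list \<Rightarrow> nat) \<Rightarrow> (bool list \<Rightarrow>
  nat) \<Rightarrow> row \<Rightarrow> bool" where
  "admissible N u = (\<lambda>(P, fs, us). (\<exists>n. N P = 2 ^ n) \<and> u P \<in> fst ` set us)"

fun chosen :: "(bool list \<Rightarrow> nat) \<Rightarrow> (bool list \<Rightarrow> nat)
  \<Rightarrow> row \<Rightarrow> choice \<Rightarrow> bool" where
  "chosen N u (P, fs, us) ((x, b), v) \<longleftrightarrow>
    in_class (N P) (x, b) \<and> x \<ge> 1 \<and> u P = v \<and> v \<in> fst ` set us"

section \<open>Soundness of the search\<close>

lemma in_class_iff: "in_class n (m, b) \<longleftrightarrow> (\<exists>j. n = m + 4 * j \<and> (b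
  \<or> j = 0))"
  by (cases b) auto

lemma in_class_meet: "in_class n a \<Longrightarrow> in_class n b \<Longrightarrow> meet a b"
proof (induction a b rule: meet.induct)
  case (4 l r)
  then obtain i j where "n = l + 4 * i" "n = r + 4 * j" unfolding in_class_iff by blast
  then have "n mod 4 = l mod 4" "n mod 4 = r mod 4" by (metis mod_mult_self2)+
  then show ?case by simp
qed (auto simp: dvd_def intro: mult.commute)

lemma weight_map: "v \<in> fst ` set us \<Longrightarrow> weight (map (\<lambda>(u, ds). (u, f
  ds)) us) v = f (the (map_of us v))"
  by (induction us) (auto, force)

lemma cell_None:
  assumes "cell Q (P, fs, us) = None" "u P \<in> fst ` set us"
  shows "row_incidence N u Q (P, fs, us) = 0"
proof -
  from assms(2) obtain ds where ds: "map_of us (u P) = Some ds"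
    by (metis map_of_eq_None_iff option.exhaust)
  then have "(u P, ds) \<in> set us" by (rule map_of_SomeD)
  then show ?thesis using assms(1) ds
    by (auto simp: row_incidence_def list_all_iff split: if_splits)
qed

text \<open>If \<open>N = y + 4 * i\<close>, a share is \<open>k * (y - 1) + w * y\<close> plus
  \<open>4 * i * (k + w)\<close>; so it becomes unbounded only if \<open>N\<close> is unbounded and
  \<open>k\<close> or \<open>w\<close> is positive.\<close>

lemma sum_cells_sound:
  "list_all2 (chosen N u) Rs as \<Longrightarrow> in_class x (m, b) \<Longrightarrow>
    in_class (x + (\<Sum>R\<leftarrow>Rs. row_incidence N u Q R)) (sum_cells (map (cell Q) Rs) as
      m b)"
proof (induction Rs as arbitrary: x m b rule: list_all2_induct)
  case (Cons R Rs a as)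
  obtain P fs us where R: "R = (P, fs, us)" by (cases R) auto
  obtain y c v where a: "a = ((y, c), v)" by (metis surj_pair)
  have ch: "in_class (N P) (y, c)" "y \<ge> 1" "u P = v" "v \<in> fst ` set us"
    using Cons(1) by (auto simp: R a)
  show ?case
  proof (cases "cell Q R")
    case None
    then have "row_incidence N u Q R = 0" using cell_None ch R by metis
    then show ?thesis using Cons None by simp
  next
    case (Some kw)
    define k where "k = count_list fs Q"
    define ws where "ws = map (\<lambda>(u, ds). (u, count_list ds Q)) us"
    have cell: "cell Q R = Some (k, ws)"
      using Some by (auto simp: R k_def ws_def split: if_splits)
    define w where "w = weight ws v"
    have "w = count_list (the (map_of us v)) Q" by (simp add: w_def ws_def weight_map ch)
    then have inc: "row_incidence N u Q R = (N P - 1) * k + N P * w"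
      by (simp add: row_incidence_def R k_def ch)
    obtain i where i: "N P = y + 4 * i" "c \<or> i = 0" using ch(1) by (auto simp: in_class_iff)
    obtain j where j: "x = m + 4 * j" "b \<or> j = 0" using Cons.prems by (auto simp: in_class_iff)
    \<comment> \<open>Here \<open>y \<ge> 1\<close> keeps the natural subtraction exact.\<close>
    have "N P - 1 = (y - 1) + 4 * i" using i ch(2) by simp
    then have inc': "row_incidence N u Q R = k * (y - 1) + w * y + 4 * (i * (k + w))"
      unfolding inc i by (simp add: algebra_simps)
    then have "x + row_incidence N u Q R = m + k * (y - 1) + w * y + 4 * (j + i * (k + w))"
      by (simp add: j algebra_simps)
    then have "in_class (x + row_incidence N u Q R)
        (m + k * (y - 1) + w * y, b \<or> c \<and> (k > 0 \<or> w > 0))"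
      unfolding in_class_iff using i(2) j(2) by (intro exI[of _ "j + i * (k + w)"]) auto
    from Cons.IH[OF this] show ?thesis
      by (cases c) (simp_all add: cell a w_def add.assoc)
  qed
qed simp

lemma own_value_sound:
  "list_all2 (chosen N u) Rs as \<Longrightarrow> Q \<in> fst ` set Rs \<Longrightarrow>
    in_class (N Q * u Q) (own_value (map (\<lambda>R. fst R = Q) Rs) as)"
proof (induction Rs as rule: list_all2_induct)
  case (Cons R Rs a as)
  obtain P fs us where R: "R = (P, fs, us)" by (cases R) auto
  obtain y c v where a: "a = ((y, c), v)" by (metis surj_pair)
  have ch: "in_class (N P) (y, c)" "u P = v" using Cons(1) by (auto simp: R a)
  show ?case
  proof (cases "P = Q")
    case True
    obtain i where "N P = y + 4 * i" "c \<or> i = 0" using ch(1) by (auto simp: in_class_iff)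
    then have "N Q * u Q = y * v + 4 * (i * v)" "c \<or> i * v = 0" using True ch by (auto simp:
      algebra_simps)
    then have "in_class (N Q * u Q) (y * v, c)" unfolding in_class_iff by blast
    then show ?thesis by (simp add: R a True)
  qed (use Cons in \<open>auto simp: R a\<close>)
qed simp

lemma choice_exists:
  assumes "admissible N u R" obtains c where "c \<in> set (choices R)" "chosen N u R c"
proof -
  obtain P fs us where R: "R = (P, fs, us)" by (cases R) auto
  obtain n where n: "N P = 2 ^ n" and u: "u P \<in> fst ` set us"
    using assms by (auto simp: admissible_def R)
  have "in_class (N P) (1, False) \<or> in_class (N P) (2, False) \<or> in_class (N P) (4, True)"
  proof (cases "n \<le> 1")
    case False
    then obtain k where "n = k + 2" by (metis add.commute le_Suc_ex not_less_eq_eq numeral_2_eq_2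
      One_nat_def)
    then have "N P = 4 + 4 * (2 ^ k - 1)" using n by (simp add: algebra_simps)
    then show ?thesis by auto
  qed (use n in \<open>auto simp: le_Suc_eq\<close>)
  moreover have "((1, False), u P) \<in> set (choices R)" "((2, False), u P) \<in> set (choices R)"
    "((4, True), u P) \<in> set (choices R)" using u by (force simp: R)+
  ultimately show thesis using that u unfolding R by (metis chosen.simps one_le_numeral order_refl)
qed

text \<open>The choices that describe the actual \<open>N\<close> and \<open>u\<close> pass every
  test, so their branch is never pruned.\<close>

lemma search_sound:
  assumes "sound_plan Rs pl" "list_all2 (chosen N u) Rs as"
    "\<And>R. R \<in> fst ` set pl \<Longrightarrow> admissible N u R"
    "\<And>Q. Q \<in> fst ` set Rs \<union> (fst \<circ> fst) ` set pl \<Longrightarrow> N Q * u Q =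
      Suc ((\<Sum>R\<leftarrow>Rs. row_incidence N u Q R) + (\<Sum>R\<leftarrow>map fst pl.
        row_incidence N u Q R))"
  shows "\<exists>as'\<in>set (search (levels Rs pl) as).
    list_all2 (chosen N u) (rev (map fst pl) @ Rs) as'"
  using assms
proof (induction pl arbitrary: Rs as)
  case (Cons RQ pl)
  obtain R Qs where RQ: "RQ = (R, Qs)" by (cases RQ)
  obtain c where c: "c \<in> set (choices R)" "chosen N u R c"
    using Cons.prems(3)[of R] choice_exists[of N u R] unfolding RQ by auto
  have agree: "list_all2 (chosen N u) (R # Rs) (c # as)" using c Cons.prems(2) by simp
  have meet: "meet (own_value (map (\<lambda>R. fst R = Q) (R # Rs)) (c # as))
      (sum_cells (map (cell Q) (R # Rs)) (c # as) 1 False)" if Q: "Q \<in> set Qs" for Q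
  proof -
    have Q': "Q \<in> fst ` set (R # Rs)" "\<And>S Ts. (S, Ts) \<in> set pl \<Longrightarrow> cell
      Q S = None"
      using Cons.prems(1) Q unfolding RQ by (auto simp: list_all_iff)
    have "row_incidence N u Q S = 0" if "(S, Ts) \<in> set pl" for S Ts
    proof -
      have "admissible N u S" using Cons.prems(3)[of S] that by (force simp: RQ)
      then show ?thesis using Q'(2)[OF that] cell_None
        by (cases S) (auto simp: admissible_def simp del: cell.simps)
    qed
    \<comment> \<open>Only assigned rows remain in the equation of \<open>Q\<close>, so its two
      sides are a common element of the two computed classes.\<close>
    then have "(\<Sum>R\<leftarrow>map fst pl. row_incidence N u Q R) = 0" by auto
    moreover have "Q \<in> fst ` set Rs \<union> (fst \<circ> fst) ` set (RQ # pl)" using Q'(1) by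
      (auto simp: RQ)
    ultimately have "N Q * u Q = 1 + (\<Sum>R\<leftarrow>R # Rs. row_incidence N u Q R)"
      using Cons.prems(4) by (simp add: RQ)
    then show ?thesis
      using own_value_sound[OF agree Q'(1)] sum_cells_sound[OF agree, of 1 1 False Q]
        in_class_meet by (metis in_class.simps(2))
  qed
  have "list_all (\<lambda>(os, cells). meet (own_value os (c # as)) (sum_cells cells (c # as) 1
    False))
      (map (\<lambda>Q. (map (\<lambda>S. fst S = Q) (R # Rs), map (cell Q) (R # Rs))) Qs)"
    using meet by (simp add: list_all_iff del: list.map)
  then have "set (search (levels (R # Rs) pl) (c # as)) \<subseteq> set (search (levels Rs (RQ #
    pl)) as)"
    using c(1) by (auto simp: RQ simp del: list.map intro!: bexI[of _ c])
  moreover have "\<exists>as'\<in>set (search (levels (R # Rs) pl) (c # as)).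
    list_all2 (chosen N u) (rev (map fst pl) @ R # Rs) as'"
    using Cons.prems agree by (intro Cons.IH) (auto simp: RQ)
  moreover have "rev (map fst (RQ # pl)) @ Rs = rev (map fst pl) @ R # Rs" by (simp add: RQ)
  ultimately show ?case by (simp only:) blast
qed auto

section \<open>From the search to an arbitrary smooth perfect polynomial\<close>

lemma core_subset: "set core \<subseteq> set factor_base" by code_simp

lemma plan_rows: "set (map fst plan) \<subseteq> set (map (\<lambda>(P, fs, us, bad). (P, fs, us))
  table)"
  by (auto simp: plan_def dest: set_zip_leftD)

lemma row_entry:
  assumes "(P, fs, us) \<in> fst ` set plan"
  shows "P \<in> set factor_base" "shifted P = fs" "orders P = map fst us" "cyc P v = the (map_of
    us v)"
proof -
  obtain bad where "(P, fs, us, bad) \<in> set table" using assms plan_rows by fastforce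
  moreover have "distinct (map fst table)" by (simp add: factor_base_table factor_base_distinct)
  ultimately have "map_of table P = Some (fs, us, bad)" "P \<in> set factor_base"
    by (auto simp: table_entry(1))
  then show "P \<in> set factor_base" "shifted P = fs" "orders P = map fst us" "cyc P v = the
    (map_of us v)"
    by (auto simp: shifted_def orders_def cyc_def entry_def)
qed

text \<open>A prime outside \<open>core\<close> has only the order 1 and occurs in no factor list of
  the table, which will force its exponent to be 0.\<close>

lemma outside_core:
  "list_all (\<lambda>(P, fs, us, bad). P \<in> set core \<or> us = [(1, [])] \<and>
    list_all (\<lambda>(R, fs, us, bad). P \<notin> set fs \<and> list_all (\<lambda>(u, ds). P
      \<notin> set ds) us) table) table"
  by code_simp

lemma cyc_one: "list_all (\<lambda>(P, fs, us, bad). map_of us 1 = Some []) table" by code_simp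

text \<open>With an odd number of terms, \<open>geo u P\<close> has the value 1 at 0 and at 1. So x
  and x + 1 enter \<open>sigma A\<close> only through the factors \<open>1 + P\<close>.\<close>

lemma cyc_odd: "list_all (\<lambda>(P, fs, us, bad). list_all (\<lambda>(u, ds). px \<notin> set
  ds \<and> py \<notin> set ds) us) table"
  by code_simp

lemma table_entry_of:
  assumes "P \<in> set factor_base"
  shows "(P, shifted P, fst (snd (entry P)), snd (snd (entry P))) \<in> set table"
proof -
  have "P \<in> fst ` set table" using assms by (simp flip: factor_base_table)
  then obtain x where "map_of table P = Some x" by (metis map_of_eq_None_iff option.exhaust)
  then show ?thesis by (simp add: shifted_def entry_def map_of_SomeD)
qed

lemma cyc_one': "P \<in> set factor_base \<Longrightarrow> cyc P 1 = []"
  using bspec[OF cyc_one[unfolded list_all_iff] table_entry_of[of P]]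
  unfolding prod.case by (simp add: cyc_def)

lemma cyc_in_entry:
  assumes "u \<in> set (orders P)"
  shows "(u, cyc P u) \<in> set (fst (snd (entry P)))"
  using assms unfolding orders_def cyc_def
  by (metis list.set_map map_of_SomeD map_of_eq_None_iff option.collapse)

lemma incidence_outside_core:
  assumes P: "P \<in> set factor_base" "P \<notin> set core" and R: "R \<in> set factor_base" "u R
    \<in> set (orders R)"
  shows "orders P = [1]" "incidence N u P R = 0"
proof -
  have t: "fst (snd (entry P)) = [(1, [])] \<and> (\<forall>x\<in>set table. case x of (R, fs, us,
    bad) \<Rightarrow>
      P \<notin> set fs \<and> (\<forall>x\<in>set us. case x of (u, ds) \<Rightarrow> P \<notin>
        set ds))"
    using bspec[OF outside_core[unfolded list_all_iff] table_entry_of[OF P(1)]] P(2)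
    by (simp only: prod.case simp_thms) (erule conjunct2)
  then show "orders P = [1]" by (simp add: orders_def)
  have "P \<notin> set (shifted R) \<and> (\<forall>x\<in>set (fst (snd (entry R))). case x of (u,
    ds) \<Rightarrow> P \<notin> set ds)"
    using bspec[OF conjunct2[OF t] table_entry_of[OF R(1)]] unfolding prod.case .
  moreover from this have "P \<notin> set (cyc R (u R))"
    using bspec[OF _ cyc_in_entry[OF R(2)], of "\<lambda>(u, ds). P \<notin> set ds"] by simp
  ultimately show "incidence N u P R = 0" by (simp add: incidence_def count_list_0_iff)
qed

lemma incidence_trivial: "P \<in> set factor_base \<Longrightarrow> N P = 1 \<Longrightarrow> u P
  = 1 \<Longrightarrow> incidence N u Q P = 0"
  using cyc_one' by (simp add: incidence_def)

lemma incidence_X: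
  assumes "P \<in> set factor_base" "u P \<in> set (orders P)" "Q \<in> {px, py}"
  shows "incidence N u Q P = (N P - 1) * count_list (shifted P) Q"
proof -
  have "list_all (\<lambda>(u, ds). px \<notin> set ds \<and> py \<notin> set ds) (fst (snd (entry
    P)))"
    using bspec[OF cyc_odd[unfolded list_all_iff[of _ table]] table_entry_of[OF assms(1)]]
    unfolding prod.case .
  then have "Q \<notin> set (cyc P (u P))"
    using bspec[OF _ cyc_in_entry[OF assms(2)], of "\<lambda>(u, ds). px \<notin> set ds \<and> py
      \<notin> set ds"] assms(3)
    by (auto simp: list_all_iff)
  then show ?thesis by (simp add: incidence_def count_list_0_iff)
qed

lemma solution_names:
  "list_all (\<lambda>s. distinct (map fst s) \<and> list_all (\<lambda>P. P \<in> set core) (map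
    fst s)) solutions"
  by code_simp

lemma core_distinct: "distinct core" by code_simp

text \<open>The search fixes \<open>u\<close> and the class of \<open>N\<close> for all primes of
  \<open>core\<close>. The last conclusion retains the exact equations for x and x + 1, which the
  search has tested only up to classes.\<close>

lemma perfect_solution:
  assumes "A \<noteq> 0" "sigma A = A" "smooth A"
  obtains N u s where "s \<in> set solutions"
    "\<And>P x b v. (P, (x, b), v) \<in> set s \<Longrightarrow> in_class (N P) (x, b) \<and> u P
      = v"
    "A = (\<Prod>P\<leftarrow>map fst s. pol P ^ (N P * u P - 1))"
    "\<And>Q. Q \<in> {px, py} \<Longrightarrow> N Q * u Q = Suc (\<Sum>P\<leftarrow>map fst s. (N
      P - 1) * count_list (shifted P) Q)"
proof -
  from perfect_exponent_equations[OF assms] obtain N u where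
    Nu: "\<And>P. P \<in> set factor_base \<Longrightarrow> (\<exists>n. N P = 2 ^ n) \<and> u P
      \<in> set (orders P)"
    and mult: "\<And>P. P \<in> set factor_base \<Longrightarrow> Suc (multiplicity (pol P) A) = N
      P * u P"
    and eqn: "\<And>Q. Q \<in> set factor_base \<Longrightarrow> N Q * u Q = Suc (\<Sum>P\<in>set
      factor_base. incidence N u Q P)"
    by metis
  \<comment> \<open>No factor of \<open>sigma A\<close> produces \<open>P\<close>, so its equation
    reads \<open>N P * u P = 1\<close>.\<close>
  have outside: "N P = 1 \<and> u P = 1" if P: "P \<in> set factor_base" "P \<notin> set core" for P
    using eqn[OF P(1)] incidence_outside_core[OF P] Nu by simp
  have eqn': "N Q * u Q = Suc (\<Sum>R\<leftarrow>map fst plan. row_incidence N u Q R)" if Q: "Q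
    \<in> set core" for Q
  proof -
    have "(\<Sum>P\<in>set factor_base. incidence N u Q P) = (\<Sum>P\<in>set core. incidence N u
      Q P)"
      using core_subset outside incidence_trivial by (intro sum.mono_neutral_right) auto
    also have "\<dots> = (\<Sum>P\<leftarrow>core. incidence N u Q P)"
      by (simp add: sum_list_distinct_conv_sum_set core_distinct)
    also have "\<dots> = (\<Sum>R\<leftarrow>map fst plan. incidence N u Q (fst R))"
      by (simp flip: plan_core add: o_def)
    also have "\<dots> = (\<Sum>R\<leftarrow>map fst plan. row_incidence N u Q R)"
    proof (rule arg_cong[of _ _ sum_list], rule map_cong[OF refl])
      fix R assume R: "R \<in> set (map fst plan)"
      obtain P fs us where "R = (P, fs, us)" by (metis surj_pair)
      then show "incidence N u Q (fst R) = row_incidence N u Q R"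
        using R row_entry[of P fs us] by (simp add: row_incidence_def incidence_def)
    qed
    finally show ?thesis using eqn Q core_subset by auto
  qed
  have "\<exists>as'\<in>set (search (levels [] plan) []). list_all2 (chosen N u) (rev (map fst
    plan) @ []) as'"
  proof (rule search_sound[OF plan_sound])
    fix R assume R: "R \<in> fst ` set plan"
    obtain P fs us where "R = (P, fs, us)" by (metis surj_pair)
    then show "admissible N u R" using R row_entry[of P fs us] Nu[of P] by (auto simp:
      admissible_def)
  next
    fix Q assume "Q \<in> fst ` set [] \<union> (fst \<circ> fst) ` set plan"
    then have "Q \<in> set core" by (auto simp flip: plan_core)
    then show "N Q * u Q = Suc ((\<Sum>R\<leftarrow>[]. row_incidence N u Q R) +
      (\<Sum>R\<leftarrow>map fst plan. row_incidence N u Q R))"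
      using eqn' by simp
  qed simp
  then obtain s where s: "s \<in> set solutions"
    "list_all2 (chosen N u) (rev (map fst plan)) (map (choice_of s) (rev core))"
    by (auto simp: search_plan)
  have "map (choice_of s) (rev core) = rev (map (choice_of s \<circ> fst) (map fst plan))"
    by (simp flip: plan_core add: rev_map)
  then have "list_all2 (chosen N u) (map fst plan) (map (choice_of s \<circ> fst) (map fst plan))"
    using s(2) by (simp add: list_all2_rev)
  then have chosen: "chosen N u R (choice_of s (fst R))" if "R \<in> set (map fst plan)" for R
  proof -
    have "list_all2 r L (map g L) \<Longrightarrow> R \<in> set L \<Longrightarrow> r R (g R)" for
      r g L
      by (simp add: list_all2_map2 list_all2_same)
    from this[OF \<open>list_all2 (chosen N u) (map fst plan) _\<close> that] show ?thesis by simp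
  qed
  have ch: "in_class (N P) (fst (choice_of s P)) \<and> u P = snd (choice_of s P)"
    if "P \<in> set core" for P
  proof -
    have "P \<in> fst ` set (map fst plan)" using that by (simp flip: plan_core add: image_image)
    then obtain R where R: "P = fst R" "R \<in> set (map fst plan)" by (rule imageE)
    obtain P' fs us where "R = (P', fs, us)" by (metis surj_pair)
    moreover obtain x b v where "choice_of s P = ((x, b), v)" by (metis surj_pair)
    ultimately show ?thesis using chosen[OF R(2)] R(1) by simp
  qed
  have names: "distinct (map fst s)" "set (map fst s) \<subseteq> set core"
    using solution_names s(1) by (auto simp: list_all_iff)
  have trivial: "N P = 1 \<and> u P = 1" if "P \<in> set factor_base" "P \<notin> set (map fst s)"
    for P
  proof (cases "P \<in> set core")
    case True
    moreover have "map_of s P = None" using that(2) by (simp add: map_of_eq_None_iff)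
    ultimately show ?thesis using ch[of P] by (simp add: choice_of_def)
  qed (use outside that in blast)
  have sub: "set (map fst s) \<subseteq> set factor_base" using names core_subset by blast
  show thesis
  proof (rule that[OF s(1)])
    fix P x b v assume P: "(P, (x, b), v) \<in> set s"
    then have "choice_of s P = ((x, b), v)" using names(1) by (simp add: choice_of_def)
    then show "in_class (N P) (x, b) \<and> u P = v" using ch[of P] names(2) P by force
  next
    have "A = (\<Prod>P\<in>set factor_base. pol P ^ (N P * u P - 1))"
      by (subst smooth_eq_prod[OF assms(1,3)], intro prod.cong refl) (simp flip: mult)
    also have "\<dots> = (\<Prod>P\<in>set (map fst s). pol P ^ (N P * u P - 1))"
      using sub trivial by (intro prod.mono_neutral_right) auto
    also have "\<dots> = (\<Prod>P\<leftarrow>map fst s. pol P ^ (N P * u P - 1))"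
      using names(1) by (rule prod.distinct_set_conv_list)
    finally show "A = (\<Prod>P\<leftarrow>map fst s. pol P ^ (N P * u P - 1))" .
  next
    fix Q assume Q: "Q \<in> {px, py}"
    have "px \<in> set factor_base" "py \<in> set factor_base" by code_simp+
    then have "N Q * u Q = Suc (\<Sum>P\<in>set factor_base. incidence N u Q P)" using eqn Q by
      blast
    also have "(\<Sum>P\<in>set factor_base. incidence N u Q P) = (\<Sum>P\<in>set (map fst s).
      incidence N u Q P)"
      using sub trivial incidence_trivial by (intro sum.mono_neutral_right) auto
    also have "\<dots> = (\<Sum>P\<leftarrow>map fst s. incidence N u Q P)"
      by (rule sum_list_distinct_conv_sum_set[OF names(1), symmetric])
    also have "\<dots> = (\<Sum>P\<leftarrow>map fst s. (N P - 1) * count_list (shifted P) Q)"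
    proof (rule arg_cong[of _ _ sum_list], rule map_cong[OF refl])
      fix P assume "P \<in> set (map fst s)"
      then show "incidence N u Q P = (N P - 1) * count_list (shifted P) Q"
        using sub Nu Q by (intro incidence_X) auto
    qed
    finally show "N Q * u Q = Suc (\<Sum>P\<leftarrow>map fst s. (N P - 1) * count_list (shifted
      P) Q)" .
  qed
qed

section \<open>Perfect polynomials\<close>

definition factored :: "(bool list \<times> nat) list \<Rightarrow> bit poly" where
  "factored L = (\<Prod>(P, e)\<leftarrow>L. pol P ^ e)"

text \<open>The polynomials \<open>T1\<close> to \<open>T11\<close> in this order, with
  \<open>bar M2 = M3\<close>, \<open>bar M4 = M5\<close> and
  \<open>1 + X + X ^ 4 = S1\<close>.\<close>

definition perfect_factorizations :: "(bool list \<times> nat) list list" where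
  "perfect_factorizations =
    [[(px, 2), (py, 1), (m1, 1)], [(px, 1), (py, 2), (m1, 1)],
     [(px, 4), (py, 3), (m4, 1)], [(px, 3), (py, 4), (m5, 1)],
     [(px, 4), (py, 4), (m4, 1), (m5, 1)],
     [(px, 6), (py, 3), (m2, 1), (m3, 1)], [(px, 3), (py, 6), (m2, 1), (m3, 1)],
     [(px, 4), (py, 6), (m2, 1), (m3, 1), (m4, 1)], [(px, 6), (py, 4), (m2, 1), (m3, 1), (m5, 1)],
     [(px, 2), (py, 1), (m1, 2), (s1, 1)], [(px, 1), (py, 2), (m1, 2), (s1, 1)]]"

lemma pol_px: "pol px = X" and pol_py: "pol py = X + 1"
  by (simp_all add: px_def py_def monom_altdef one_pCons)

lemma bar_hom: "bar (p + q) = bar p + bar q" "bar (p * q) = bar p * bar q" "bar (p ^ n) = bar p ^ n"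
  "bar 1 = 1" "bar X = X + 1" "bar (X + 1) = X"
  by (simp_all add: bar_def pcompose_add pcompose_mult pcompose_power pcompose_1 pcompose_pCons)

lemmas base_defs = m1_def m2_def m3_def m4_def m5_def m6_def m7_def m8_def m9_def m10_def m11_def
  m12_def m13_def s1_def s2_def s3_def s4_def s5_def s6_def s7_def s8_def s9_def s10_def s11_def
  s12_def s13_def s14_def s15_def

lemmas M_defs = M1_def M2_def M3_def M4_def M5_def M6_def M7_def M8_def M9_def M10_def M11_def
  M12_def M13_def

lemmas S_defs = S1_def S2_def S3_def S4_def S5_def S6_def S7_def S8_def S9_def S10_def S11_def
  S12_def S13_def S14_def S15_def

lemma pol_m: "pol m1 = M1" "pol m2 = M2" "pol m3 = M3" "pol m4 = M4" "pol m5 = M5" "pol m6 = M6"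
  "pol m7 = M7" "pol m8 = M8" "pol m9 = M9" "pol m10 = M10" "pol m11 = M11" "pol m12 = M12"
  "pol m13 = M13"
  unfolding base_defs M_defs bar_hom
  by (simp_all add: eval_nat_numeral one_pCons monom_Suc monom_0)

lemma pol_s: "pol s1 = S1" "pol s2 = S2" "pol s3 = S3" "pol s4 = S4" "pol s5 = S5" "pol s6 = S6"
  "pol s7 = S7" "pol s8 = S8" "pol s9 = S9" "pol s10 = S10" "pol s11 = S11" "pol s12 = S12"
  "pol s13 = S13" "pol s14 = S14" "pol s15 = S15"
  unfolding base_defs M_defs S_defs
  by (simp_all add: eval_nat_numeral one_pCons monom_Suc monom_0)

lemma pol_factor_base: "pol ` set factor_base = insert X (insert (X + 1) F_set)"
  unfolding factor_base_def F_set_def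
  by (simp add: pol_px pol_py pol_m pol_s insert_commute)

lemma bar_M: "bar M1 = M1" "bar M2 = M3" "bar M3 = M2" "bar M4 = M5" "bar M5 = M4"
  "1 + X + X ^ 4 = S1" "bar S1 = S1"
  unfolding M_defs S_defs bar_hom
  by (simp_all add: eval_nat_numeral one_pCons)

lemma X_1_1: "X + 1 + 1 = X"
  by (metis add.commute add_add_self_bit_poly)

lemma T_eq:
  "T1 = X ^ 2 * (X + 1) * M1" "T2 = X * (X + 1) ^ 2 * M1"
  "T3 = X ^ 4 * (X + 1) ^ 3 * M4" "T4 = X ^ 3 * (X + 1) ^ 4 * M5"
  "T5 = X ^ 4 * (X + 1) ^ 4 * M4 * M5"
  "T6 = X ^ 6 * (X + 1) ^ 3 * M2 * M3" "T7 = X ^ 3 * (X + 1) ^ 6 * M2 * M3"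
  "T8 = X ^ 4 * (X + 1) ^ 6 * M2 * M3 * M4" "T9 = X ^ 6 * (X + 1) ^ 4 * M2 * M3 * M5"
  "T10 = X ^ 2 * (X + 1) * M1 ^ 2 * S1" "T11 = X * (X + 1) ^ 2 * M1 ^ 2 * S1"
  unfolding T1_def T2_def T3_def T4_def T5_def T6_def T7_def T8_def T9_def T10_def T11_def
    bar_hom bar_M by (simp_all only: mult_ac X_1_1)

lemma T_set_eq: "T_set = factored ` set perfect_factorizations"
  unfolding T_set_def T_eq perfect_factorizations_def factored_def
  by (simp add: pol_px pol_py pol_m pol_s mult.assoc del: mult_pCons_left mult_pCons_right)

lemma bar_T_set: "A \<in> T_set \<Longrightarrow> bar A \<in> T_set"
  unfolding T_set_def T_eq by (auto simp only: insert_iff empty_iff bar_hom bar_M X_1_1 mult_ac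
    simp_thms)


section \<open>The listed polynomials are perfect\<close>

lemma perfect_factorizations_check:
  "list_all (\<lambda>L. distinct (map fst L) \<and> over_base (map fst L) \<and>
    trim (mul_list (map (\<lambda>(P, e). geo_list (Suc e) P) L)) =
    trim (mul_list (concat (map (\<lambda>(P, e). replicate e P) L)))) perfect_factorizations"
  by code_simp

lemma factored_eq: "factored L = (\<Prod>f\<leftarrow>concat (map (\<lambda>(P, e). replicate e P)
  L). pol f)"
  unfolding factored_def by (induction L) (auto simp: prod_list_replicate)

lemma perfect_factored:
  assumes "L \<in> set perfect_factorizations" shows "perfect_poly (factored L)"
proof -
  have L: "distinct (map fst L)" "set (map fst L) \<subseteq> set factor_base"
    and eq: "trim (mul_list (map (\<lambda>(P, e). geo_list (Suc e) P) L)) =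
      trim (mul_list (concat (map (\<lambda>(P, e). replicate e P) L)))"
    using perfect_factorizations_check assms by (auto simp: list_all_iff over_base_def)
  have "\<And>R. R \<in> pol ` set (map fst L) \<Longrightarrow> prime R" using L
    factor_base_prime by auto
  have inj: "inj_on pol (set (map fst L))" using inj_on_pol_factor_base L(2) by (rule inj_on_subset)
  \<comment> \<open>\<open>sigma_prod_prime_powers\<close> takes exponents as a function of the
    primes, so \<open>pol\<close> is inverted on the names in \<open>L\<close>.\<close>
  define e where "e = (\<lambda>R. the (map_of L (the_inv_into (set (map fst L)) pol R)))"
  have e: "e (pol P) = n" if "(P, n) \<in> set L" for P n
  proof -
    have "P \<in> set (map fst L)" using that by force
    then show ?thesis using that L(1) inj by (simp add: e_def the_inv_into_f_f)
  qed
  have prods: "(\<Prod>R\<in>pol ` set (map fst L). f R (e R)) = (\<Prod>(P, n)\<leftarrow>L. f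
    (pol P) n)" for f :: "bit poly \<Rightarrow> nat \<Rightarrow> bit poly"
  proof -
    have "(\<Prod>R\<in>pol ` set (map fst L). f R (e R)) = (\<Prod>P\<in>set (map fst L). f (pol
      P) (e (pol P)))"
      by (simp only: prod.reindex[OF inj] o_def)
    also have "\<dots> = (\<Prod>P\<leftarrow>map fst L. f (pol P) (e (pol P)))"
      using L(1) by (rule prod.distinct_set_conv_list)
    also have "\<dots> = (\<Prod>(P, n)\<leftarrow>L. f (pol P) n)"
      unfolding map_map using e by (intro arg_cong[of _ _ prod_list] map_cong refl) auto
    finally show ?thesis .
  qed
  have "sigma (factored L) = (\<Prod>(P, n)\<leftarrow>L. geo (Suc n) (pol P))"
    using sigma_prod_prime_powers[of "pol ` set (map fst L)" e] L factor_base_prime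
      prods[of "\<lambda>R n. R ^ n"] prods[of "\<lambda>R n. geo (Suc n) R"]
    by (auto simp: factored_def simp del: sum.lessThan_Suc)
  also have "\<dots> = pol (mul_list (map (\<lambda>(P, e). geo_list (Suc e) P) L))"
    by (simp add: o_def case_prod_unfold del: sum.lessThan_Suc)
  also have "\<dots> = pol (mul_list (concat (map (\<lambda>(P, e). replicate e P) L)))"
    using eq pol_trim by metis
  also have "\<dots> = factored L" by (simp add: factored_eq)
  finally have "sigma (factored L) = factored L" .
  moreover have "factored L \<noteq> 0"
    using L factor_base_prime by (fastforce simp: factored_def prod_list_zero_iff)
  ultimately show ?thesis by (simp add: perfect_poly_def)
qed

section \<open>Classification and conclusion\<close>

lemma shifted_counts:
  "map (\<lambda>P. (count_list (shifted P) px, count_list (shifted P) py)) [px, py, m1, m2, m3,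
    m4, m5, s1] =
    [(0, 1), (1, 0), (1, 1), (1, 2), (2, 1), (1, 3), (3, 1), (1, 1)]"
  by code_simp

text \<open>The exact equations for x and x + 1 determine each \<open>N\<close> known only as a
  multiple of 4. The exception is the solution where \<open>px\<close> and \<open>py\<close> alone
  occur, both unbounded: there they say that the exponents are equal.\<close>

lemma smooth_perfect:
  assumes "perfect_poly A" "smooth A"
  shows "A \<in> T_set \<or> (\<exists>k. A = (X * (X + 1)) ^ k)"
proof -
  have A0: "A \<noteq> 0" and "sigma A = A" using assms(1) by (simp_all add: perfect_poly_def)
  obtain N u s where s: "s \<in> set solutions"
    and Nu: "\<And>P x b v. (P, (x, b), v) \<in> set s \<Longrightarrow> in_class (N P) (x, b)
      \<and> u P = v"
    and A: "A = (\<Prod>P\<leftarrow>map fst s. pol P ^ (N P * u P - 1))"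
    and eqn: "\<And>Q. Q \<in> {px, py} \<Longrightarrow>
      N Q * u Q = Suc (\<Sum>P\<leftarrow>map fst s. (N P - 1) * count_list (shifted P) Q)"
    by (rule perfect_solution[OF A0 \<open>sigma A = A\<close> assms(2)]) (rule that)
  define L where "L = map (\<lambda>P. (P, N P * u P - 1)) (map fst s)"
  have "A = factored L" unfolding A L_def factored_def by (simp add: o_def)
  note counts = shifted_counts[unfolded list.map list.inject prod.inject]
  have "list_all (\<lambda>(P, c, v). in_class (N P) c \<and> u P = v) s"
    using Nu by (auto simp: list_all_iff)
  moreover have "N px * u px = Suc (\<Sum>P\<leftarrow>map fst s. (N P - 1) * count_list (shifted
    P) px)"
    "N py * u py = Suc (\<Sum>P\<leftarrow>map fst s. (N P - 1) * count_list (shifted P) py)"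
    using eqn by blast+
  ultimately have "L \<in> set perfect_factorizations \<or> (\<exists>k. L = [(px, k), (py, k)])
    \<or> L = []"
    using s unfolding L_def
    by (simp only: solutions_def list.set insert_iff empty_iff simp_thms)
      (elim disjE, simp_all only: list.map list.pred_inject prod.case in_class.simps fst_conv
        sum_list.Cons
        sum_list.Nil counts, simp_all add: perfect_factorizations_def)
  then show ?thesis
  proof (elim disjE exE)
    assume "L \<in> set perfect_factorizations"
    then show ?thesis using \<open>A = factored L\<close> T_set_eq by blast
  next
    fix k assume "L = [(px, k), (py, k)]"
    then have "A = (X * (X + 1)) ^ k"
      using \<open>A = factored L\<close> by (simp only: factored_def list.map prod_list.Cons prod_list.Nil
        prod.case pol_px pol_py power_mult_distrib mult_1_right)
    then show ?thesis by blast
  next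
    assume "L = []"
    then have "A = (X * (X + 1)) ^ 0" using \<open>A = factored L\<close> by (simp add:
      factored_def)
    then show ?thesis by blast
  qed
qed

lemma X_dvd_T_set: "A \<in> T_set \<Longrightarrow> X dvd A"
  unfolding T_set_def T_eq by (auto intro!: dvd_mult2 dvd_power simp del: mult_pCons_left)

lemma smooth_perfect_X_dvd:
  assumes "perfect_poly A" "smooth A" "degree A > 0" shows "X dvd A"
  using smooth_perfect[OF assms(1,2)]
proof (elim disjE exE)
  fix k assume A: "A = (X * (X + 1)) ^ k"
  then have "k > 0" using assms(3) by (cases k) auto
  then show ?thesis unfolding A by (metis dvd_power dvd_triv_left dvd_trans)
qed (rule X_dvd_T_set)

lemma prime_X: "prime X" and prime_X_plus_1: "prime (X + 1)"
proof -
  have "px \<in> set factor_base" "py \<in> set factor_base" by code_simp+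
  then show "prime X" "prime (X + 1)" using factor_base_prime pol_px pol_py by metis+
qed

theorem theorem1p1:
  fixes A :: "bit poly"
  assumes "even_poly A"
    and "\<not> splits A"
    and "\<And>P. irreducible P \<Longrightarrow> odd_poly P \<Longrightarrow> P dvd A
      \<Longrightarrow> P \<in> F_set"
  shows "indecomposable_perfect A \<longleftrightarrow> A \<in> T_set \<and> bar A \<in> T_set"
proof -
  have "A \<noteq> 0" using assms(1) by (simp add: even_poly_def)
  have "smooth A"
    unfolding smooth_def pol_factor_base
  proof (intro allI impI)
    fix R assume R: "prime R" "R dvd A"
    show "R \<in> insert X (insert (X + 1) F_set)"
    proof (cases "odd_poly R")
      case False
      \<comment> \<open>An irreducible that is not odd is x or x + 1.\<close>
      then have "X dvd R \<or> X + 1 dvd R" using R by (auto simp: odd_poly_def even_poly_def)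
      then show ?thesis using R(1) prime_X prime_X_plus_1 primes_dvd_imp_eq by blast
    qed (use assms(3) R prime_bit_poly_iff in auto)
  qed
  show ?thesis
  proof
    assume "indecomposable_perfect A"
    then have "perfect_poly A" by (simp add: indecomposable_perfect_def)
    then consider "A \<in> T_set" | k where "A = (X * (X + 1)) ^ k"
      using smooth_perfect \<open>smooth A\<close> by blast
    then show "A \<in> T_set \<and> bar A \<in> T_set"
    proof cases
      case 2
      \<comment> \<open>A power of x(x + 1) has at most two irreducible factors, so it splits,
        contrary to the hypothesis.\<close>
      have "{P. irreducible P \<and> P dvd A} \<subseteq> {X, X + 1}"
      proof
        fix P assume "P \<in> {P. irreducible P \<and> P dvd A}"
        then have "prime P" "P dvd (X * (X + 1)) ^ k" using 2 by (auto simp: prime_bit_poly_iff)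
        then have "P dvd X \<or> P dvd X + 1" using prime_dvd_power prime_dvd_mult_iff by blast
        then show "P \<in> {X, X + 1}"
          using \<open>prime P\<close> prime_X prime_X_plus_1 primes_dvd_imp_eq by blast
      qed
      then have "omega A \<le> card {X, X + 1}" unfolding omega_def by (intro card_mono) auto
      also have "\<dots> \<le> 2" by (simp add: card_insert_if)
      finally show ?thesis using assms(1,2) by (simp add: splits_def)
    qed (simp add: bar_T_set)
  next
    assume "A \<in> T_set \<and> bar A \<in> T_set"
    then have "A \<in> factored ` set perfect_factorizations" by (simp only: T_set_eq)
    then have "perfect_poly A" using perfect_factored by blast
    moreover have False
      if BC: "A = B * C" "coprime B C" "degree B > 0" "degree C > 0" "perfect_poly B"
        "perfect_poly C"
      for B C
    proof -
      \<comment> \<open>Both factors inherit smoothness from \<open>A\<close>, so the classification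
        makes x a common divisor.\<close>
      have "smooth B" "smooth C" using smooth_dvd[OF \<open>smooth A\<close>] BC(1) by auto
      then have "X dvd B" "X dvd C" using BC smooth_perfect_X_dvd by blast+
      then have "is_unit X" using BC(2) coprime_common_divisor by blast
      then show False using prime_X not_prime_unit by blast
    qed
    ultimately show "indecomposable_perfect A" unfolding indecomposable_perfect_def by blast
  qed
qed

end
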